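(* Let $P\subseteq\mathbb{R}_{\ge 0}^d$ be a lattice polytope over the semiring $S_{\max,\cdot}$. Then the counting function $k\mapsto \#(kP\cap\mathbb{Z}^d)$ agrees with a polynomial of degree $\dim(P)\le d$ in $k$ for all positive integers $k$. Moreover, the coefficient of $k^d$ in this polynomial equals the Euclidean ($d$-dimensional) volume of $P$.
   Context: $S_{\max,\cdot}=(\mathbb{R}_{\ge0},\max,\cdot)$. A polytope over $S_{\max,\cdot}$ is a set of the form $P=\{x\in\mathbb{R}_{\ge0}^d : x_i=\max_j \lambda_j w_{ij}\ (1\le i\le d),\ \lambda_1,\dots,\lambda_n\ge 0,\ \max_j\lambda_j=1\}$ for finitely many points $w_1,\dots,w_n\in\mathbb{R}_{\ge0}^d$, $w_j=(w_{1j},\dots,w_{dj})$. There is a unique minimal generating set; take $w_1,\dots,w_n$ to be it. Covector decomposition: put $w_{0j}=1$ and $x_0=1$. For $G\subseteq\{0,\dots,d\}\times[n]$ let $C_G=\{x\in\mathbb{R}_{\ge0}^d : w_{kj}x_i\le w_{ij}x_k \text{ for all }(i,j)\in G,\ k\in\{0,\dots,d\}\}$. The closed cells of the covector decomposition of $P$ are the nonempty sets $C_G$ such that every $i\in\{0,\dots,d\}$ occurs in some $(i,j)\in G$ and every $j\in[n]$ occurs in some $(i,j)\in G$ with $w_{ij}>0$. They are (ordinary) convex polytopes, form a polyhedral complex, and their union is $P$. The $0$-dimensional cells are called pseudovertices, and $\dim(P)$ is the maximal dimension of a cell. $P$ is called a lattice polytope (over $S_{\max,\cdot}$) if all its pseudovertices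 lie in $\mathbb{Z}^d$. $kP=\{kx:x\in P\}$ is the ordinary dilate. *)

theory Defs
  imports "HOL-Analysis.Analysis" "HOL-Computational_Algebra.Polynomial"
begin

section \<open>Polytopes over the semiring of nonnegative reals with max and times\<close>

definition max_combination ::
    "(real ^ 'd) set \<Rightarrow> (real ^ 'd \<Rightarrow> real) \<Rightarrow> real ^ 'd \<Rightarrow> bool" where
  "max_combination W l x \<longleftrightarrow>
     (\<forall>w\<in>W. 0 \<le> l w) \<and> (MAX w\<in>W. l w) = 1 \<and> (\<forall>i. x $ i = (MAX w\<in>W. l w * w $ i))"

definition generates :: "(real ^ 'd) set \<Rightarrow> (real ^ 'd) set \<Rightarrow> bool" where
  "generates W P \<longleftrightarrow>
     finite W \<and> W \<noteq> {} \<and> (\<forall>w\<in>W. \<forall>i. 0 \<le> w $ i) \<and> P = {x. \<exists>l. max_combination W l x}"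

definition max_polytope :: "(real ^ 'd) set \<Rightarrow> bool" where
  "max_polytope P \<longleftrightarrow> (\<exists>W. generates W P)"

definition minimal_generating_set :: "(real ^ 'd) set \<Rightarrow> (real ^ 'd) set \<Rightarrow> bool" where
  "minimal_generating_set W P \<longleftrightarrow> generates W P \<and> (\<forall>V. V \<subset> W \<longrightarrow> \<not> generates V P)"

text \<open>Well-defined for every polytope by \<open>ex1_minimal_generating_set\<close> below.\<close>

definition generators :: "(real ^ 'd) set \<Rightarrow> (real ^ 'd) set" where
  "generators P = (THE W. minimal_generating_set W P)"

lemma max_combination_iff:
  fixes W :: "(real ^ 'd) set"
  assumes "finite W" "W \<noteq> {}"
  shows "max_combination W l x \<longleftrightarrow>
    (\<forall>w\<in>W. 0 \<le> l w \<and> l w \<le> 1) \<and> (\<exists>w\<in>W. l w = 1) \<and>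
    (\<forall>i. (\<forall>w\<in>W. l w * w $ i \<le> x $ i) \<and> (\<exists>w\<in>W. l w * w $ i = x $ i))"
proof -
  have "(MAX w\<in>W. f w) = c \<longleftrightarrow> (\<forall>w\<in>W. f w \<le> c) \<and> (\<exists>w\<in>W. f w = c)"
    for f :: "real ^ 'd \<Rightarrow> real" and c
    using assms by (subst Max_eq_iff) auto
  then have "max_combination W l x \<longleftrightarrow> (\<forall>w\<in>W. 0 \<le> l w) \<and>
      ((\<forall>w\<in>W. l w \<le> 1) \<and> (\<exists>w\<in>W. l w = 1)) \<and>
      (\<forall>i. (\<forall>w\<in>W. l w * w $ i \<le> x $ i) \<and> (\<exists>w\<in>W. l w * w $ i = x $ i))"
    unfolding max_combination_def by (metis (no_types, lifting))
  then show ?thesis by blast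
qed

lemma max_combination_compose:
  fixes V W :: "(real ^ 'd) set"
  assumes V: "finite V" "V \<noteq> {}" and W: "finite W" "W \<noteq> {}" "\<forall>w\<in>W. \<forall>i. 0 \<le> w $ i"
    and l: "max_combination V l x" and m: "\<And>v. v \<in> V \<Longrightarrow> max_combination W (m v) v"
  shows "max_combination W (\<lambda>w. MAX v\<in>V. l v * m v w) x"
proof -
  define n where "n w = (MAX v\<in>V. l v * m v w)" for w
  have ge: "l v * m v w \<le> n w" if "v \<in> V" for v w
    unfolding n_def using V that by (intro Max_ge) auto
  have att: "\<exists>v\<in>V. n w = l v * m v w" for w
  proof -
    have "n w \<in> (\<lambda>v. l v * m v w) ` V" unfolding n_def using V by (intro Max_in) auto
    then show ?thesis by blast
  qed
  note l' = l[unfolded max_combination_iff[OF V]]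
  note m' = m[unfolded max_combination_iff[OF W(1,2)]]
  have bnd: "0 \<le> n w \<and> n w \<le> 1" if "w \<in> W" for w
    using att[of w] l' m' that by (auto simp: mult_le_one)
  obtain v where v: "v \<in> V" "l v = 1" using l' by blast
  obtain w where w: "w \<in> W" "m v w = 1" using m' v by blast
  have "n w = 1" using ge[OF v(1), of w] bnd[OF w(1)] v w by simp
  then have one: "\<exists>w\<in>W. n w = 1" using w by blast
  have le: "n w * w $ i \<le> x $ i" if "w \<in> W" for w i
  proof -
    obtain v where v: "v \<in> V" "n w = l v * m v w" using att by blast
    have "n w * w $ i = l v * (m v w * w $ i)" using v by simp
    also have "\<dots> \<le> l v * v $ i" using l' m' v that by (intro mult_left_mono) auto
    also have "\<dots> \<le> x $ i" using l' v by blast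
    finally show ?thesis .
  qed
  have eq: "\<exists>w\<in>W. n w * w $ i = x $ i" for i
  proof -
    obtain v where v: "v \<in> V" "l v * v $ i = x $ i" using l' by blast
    obtain w where w: "w \<in> W" "m v w * w $ i = v $ i" using m' v by blast
    have "x $ i = (l v * m v w) * w $ i" using v w by (simp add: mult.assoc)
    also have "\<dots> \<le> n w * w $ i" using ge[OF v(1), of w] W(3) w by (intro mult_right_mono) auto
    finally show ?thesis using le[OF w(1), of i] w(1) by force
  qed
  show ?thesis
    using bnd one le eq unfolding max_combination_iff[OF W(1,2)] n_def[symmetric] by blast
qed

lemma generator_mem:
  assumes "generates W P" "w \<in> W" shows "w \<in> P"
proof -
  have W: "finite W" "W \<noteq> {}" "\<forall>w\<in>W. \<forall>i. 0 \<le> w $ i"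
    using assms unfolding generates_def by auto
  have "max_combination W (\<lambda>u. if u = w then 1 else 0) w"
    unfolding max_combination_iff[OF W(1,2)] using assms W(3) by auto
  then show ?thesis using assms unfolding generates_def by blast
qed

lemma minimal_generating_set_subset:
  assumes mW: "minimal_generating_set W P" and gV: "generates V P"
  shows "W \<subseteq> V"
proof
  fix w assume w: "w \<in> W"
  have gW: "generates W P" using mW unfolding minimal_generating_set_def by blast
  have V: "finite V" "V \<noteq> {}" "\<forall>w\<in>V. \<forall>i. 0 \<le> w $ i" "P = {x. \<exists>l. max_combination V l x}"
    using gV unfolding generates_def by auto
  have W: "finite W" "W \<noteq> {}" "\<forall>w\<in>W. \<forall>i. 0 \<le> w $ i" "P = {x. \<exists>l. max_combination W l x}"
    using gW unfolding generates_def by auto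
  obtain l where l: "max_combination V l w"
    using generator_mem[OF gW w] V(4) by blast
  have "\<exists>m. max_combination W m v" if "v \<in> V" for v
    using generator_mem[OF gV that] W(4) by blast
  then obtain m where m: "\<And>v. v \<in> V \<Longrightarrow> max_combination W (m v) v" by metis
  define n where "n u = (MAX v\<in>V. l v * m v u)" for u
  have n: "max_combination W n w"
    using max_combination_compose[OF V(1,2) W(1-3) l m] unfolding n_def by simp
  note l' = l[unfolded max_combination_iff[OF V(1,2)]]
  note m' = m[unfolded max_combination_iff[OF W(1,2)]]
  note n' = n[unfolded max_combination_iff[OF W(1,2)]]
  have "n w = 1"
  proof (rule ccontr)
    assume neq: "n w \<noteq> 1"
    let ?U = "W - {w}"
    obtain u where u: "u \<in> ?U" "n u = 1" using n' neq by blast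
    have U: "finite ?U" "?U \<noteq> {}" "\<forall>w\<in>?U. \<forall>i. 0 \<le> w $ i" using u W by auto
    have "\<exists>u\<in>?U. n u * u $ i = w $ i" for i
    proof -
      obtain y where y: "y \<in> W" "n y * y $ i = w $ i" using n' by blast
      show ?thesis
      proof (cases "y = w")
        case True
        then have "w $ i = 0" using y neq by simp
        moreover have "n u * u $ i \<le> w $ i" using n' u by blast
        moreover have "0 \<le> u $ i" using U(3) u by blast
        ultimately show ?thesis using u by (intro bexI[of _ u]) auto
      qed (use y in auto)
    qed
    then have nU: "max_combination ?U n w"
      unfolding max_combination_iff[OF U(1,2)] using n' u by blast
    have "\<exists>c. max_combination ?U c y" if "y \<in> W" for y
    proof (cases "y = w")
      case False
      then show ?thesis using that U(3)
        by (intro exI[of _ "\<lambda>u. if u = y then 1 else 0"])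
           (auto simp: max_combination_iff[OF U(1,2)])
    qed (use nU in blast)
    then obtain c where c: "\<And>y. y \<in> W \<Longrightarrow> max_combination ?U (c y) y" by metis
    have "P \<subseteq> {x. \<exists>l. max_combination ?U l x}"
      using max_combination_compose[OF W(1,2) U _ c] unfolding W(4) by blast
    moreover have "{x. \<exists>l. max_combination ?U l x} \<subseteq> P"
    proof safe
      fix x k assume k: "max_combination ?U k x"
      have "\<And>y. y \<in> ?U \<Longrightarrow> max_combination W (\<lambda>u. if u = y then 1 else 0) y"
        unfolding max_combination_iff[OF W(1,2)] using W(3) by auto
      from max_combination_compose[OF U(1,2) W(1-3) k this]
      show "x \<in> P" unfolding W(4) by blast
    qed
    ultimately have "generates ?U P" using U unfolding generates_def by blast
    then show False using mW w unfolding minimal_generating_set_def by blast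
  qed
  moreover have "n w \<in> (\<lambda>v. l v * m v w) ` V"
    unfolding n_def using V(1,2) by (intro Max_in) auto
  ultimately obtain v where v: "v \<in> V" "l v * m v w = 1" by auto
  have b: "0 \<le> l v" "l v \<le> 1" "0 \<le> m v w" "m v w \<le> 1" using l' m' v w by auto
  have "1 \<le> l v" using mult_left_mono[OF b(4) b(1)] v by simp
  moreover have "1 \<le> m v w" using mult_right_mono[OF b(2) b(3)] v by simp
  ultimately have one: "l v = 1" "m v w = 1" using b by auto
  have "w $ i = v $ i" for i
  proof (rule antisym)
    have "m v w * w $ i \<le> v $ i" using m'[OF v(1)] w by blast
    then show "w $ i \<le> v $ i" using one by simp
    have "l v * v $ i \<le> w $ i" using l' v by blast
    then show "v $ i \<le> w $ i" using one by simp
  qed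
  then have "w = v" by (simp add: vec_eq_iff)
  then show "w \<in> V" using v by simp
qed

lemma ex1_minimal_generating_set:
  assumes "max_polytope P"
  shows "\<exists>!W. minimal_generating_set W P"
proof -
  obtain W0 where W0: "generates W0 P" using assms unfolding max_polytope_def by blast
  obtain W where W: "generates W P" "\<And>V. generates V P \<Longrightarrow> card W \<le> card V"
    using ex_has_least_nat[of "\<lambda>W. generates W P" W0 card] W0 by blast
  have "minimal_generating_set W P"
    unfolding minimal_generating_set_def
    using W psubset_card_mono[of W] unfolding generates_def by (meson leD)
  moreover have "V = W" if "minimal_generating_set V P" "minimal_generating_set W P" for V W
    using that minimal_generating_set_subset
    by (metis minimal_generating_set_def subset_antisym)
  ultimately show ?thesis by blast
qed


section \<open>Covector decomposition\<close>

text \<open>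
  The index set \<open>{0, \<dots>, d}\<close> is \<open>'d option\<close>, with \<open>None\<close> in the role of \<open>0\<close>. Generators
  are indexed by themselves, so a set \<open>G\<close> consists of pairs \<open>(i, w)\<close>.
\<close>

definition hcoord :: "real ^ 'd \<Rightarrow> 'd option \<Rightarrow> real" where
  "hcoord x i = (case i of None \<Rightarrow> 1 | Some j \<Rightarrow> x $ j)"

definition covector_set :: "('d option \<times> (real ^ 'd)) set \<Rightarrow> (real ^ 'd) set" where
  "covector_set G = {x. (\<forall>i. 0 \<le> x $ i) \<and>
     (\<forall>(i, w)\<in>G. \<forall>k. hcoord w k * hcoord x i \<le> hcoord w i * hcoord x k)}"

definition cells :: "(real ^ 'd) set \<Rightarrow> (real ^ 'd) set set" where
  "cells P = {covector_set G | G.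
     G \<subseteq> UNIV \<times> generators P \<and> covector_set G \<noteq> {} \<and>
     (\<forall>i. \<exists>w. (i, w) \<in> G) \<and>
     (\<forall>w\<in>generators P. \<exists>i. (i, w) \<in> G \<and> 0 < hcoord w i)}"

definition pseudovertices :: "(real ^ 'd) set \<Rightarrow> (real ^ 'd) set" where
  "pseudovertices P = \<Union>{C \<in> cells P. aff_dim C = 0}"

definition polytope_dim :: "(real ^ 'd) set \<Rightarrow> int" where
  "polytope_dim P = (MAX C\<in>cells P. aff_dim C)"

definition integer_points :: "(real ^ 'd) set" where
  "integer_points = {x. \<forall>i. x $ i \<in> \<int>}"

definition lattice_polytope :: "(real ^ 'd) set \<Rightarrow> bool" where
  "lattice_polytope P \<longleftrightarrow> max_polytope P \<and> pseudovertices P \<subseteq> integer_points"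

end

theory Submission imports Defs begin

text \<open>
  The relative interiors of the cells partition \<open>P\<close>: a point \<open>x\<close> of \<open>P\<close> lies in the relative
  interior of the cell of all pairs \<open>(i, w)\<close> with \<open>w\<^sub>k x\<^sub>i \<le> w\<^sub>i x\<^sub>k\<close> for every \<open>k\<close>, and two
  cells meet in a common face. Every extreme point of a cell is a pseudovertex, hence integral. The
  relative interior of each cell splits further into disjoint open simplices spanned by its extreme
  points; triangulations of different cells need not be compatible. An open lattice simplex of
  dimension \<open>m\<close> contributes a polynomial of degree \<open>m\<close> with positive leading coefficient to the
  lattice point count of the dilates with \<open>k > 0\<close>. Leading terms therefore cannot cancel, and
  the degree is the largest dimension of a cell. The volume is the limit of the number of lattice
  points of \<open>k P\<close> divided by \<open>k\<^sup>d\<close>.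
\<close>

section \<open>Decomposition of polytopes into open simplices\<close>

text \<open>\<open>P\<close> need not be convex, and its cells overlap along faces. With relatively
  open pieces the count becomes a plain sum of their counts, with no inclusion-exclusion. At k = 0
  scaling collapses all pieces to one point and disjointness is lost, so this additivity is tied to
  positive k. Logarithms would turn the inequalities \<open>w_k x_i <= w_i x_k\<close> into bounds
  on differences, but coordinates of points and generators may vanish. The arguments on cells
  therefore stay with the inequalities themselves, in homogeneous form with an extra coordinate
  equal to 1. That every generator \<open>w\<close> occurs in a pair \<open>(i, w)\<close> with
  \<open>w_i > 0\<close> is what permits division by a coordinate. That some simplex attains the
  dimension of \<open>P\<close> rests on the fact that a convex set cannot be covered by finitely
  many pieces of smaller dimension.\<close>

definition visible_from :: "'a::real_vector \<Rightarrow> 'a set \<Rightarrow> 'a \<Rightarrow> bool" where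
  "visible_from v K y \<longleftrightarrow> y \<in> K \<and> (\<forall>s. 0 < s \<and> s \<le> 1 \<longrightarrow> s *\<^sub>R v + (1 - s) *\<^sub>R y \<notin> K)"

text \<open>If the segment from \<open>x\<close> to \<open>v\<close> met \<open>K\<close> again, the
  segment \<open>x y\<close> could be prolonged beyond \<open>y\<close> to some \<open>z\<close> in
  \<open>A\<close>, and in the triangle \<open>v\<close>, \<open>x\<close>, \<open>z\<close> a point
  of \<open>K\<close> would appear between \<open>y\<close> and \<open>v\<close>. Hence an open
  simplex is seen from \<open>v\<close> entirely or not at all.\<close>

lemma visible_from_rel_interior:
  fixes K :: "'a::euclidean_space set"
  assumes K: "convex K" and A: "convex A" "A \<subseteq> K"
    and y: "y \<in> rel_interior A" "visible_from v K y" and x: "x \<in> A"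
  shows "visible_from v K x"
  unfolding visible_from_def
proof (intro conjI allI impI notI)
  show "x \<in> K" using A x by blast
  fix s :: real assume s: "0 < s \<and> s \<le> 1" and mem: "s *\<^sub>R v + (1 - s) *\<^sub>R x \<in> K"
  show False
  proof (cases "s = 1")
    case True
    then have "1 *\<^sub>R v + (1 - 1) *\<^sub>R y \<in> K" using mem by simp
    then show False using y(2) unfolding visible_from_def by (meson le_numeral_extra(4) zero_less_one)
  next
    case False
    then have s1: "s < 1" using s by simp
    obtain e where e: "e > 1" "(1 - e) *\<^sub>R x + e *\<^sub>R y \<in> A"
      using convex_rel_interior_iff[OF A(1), of y] x y(1) by blast
    define z where "z = (1 - e) *\<^sub>R x + e *\<^sub>R y"
    \<comment> \<open>Chosen so that \<open>x\<close> cancels from the combination of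
      \<open>s *\<^sub>R v + (1 - s) *\<^sub>R x\<close> and \<open>z\<close>, leaving a point of
      the line through \<open>v\<close> and \<open>y\<close>.\<close>
    define a where "a = (e - 1) / (e - s)"
    have a: "0 < a" "a < 1" using e s1 unfolding a_def by (auto simp: field_simps)
    have zK: "z \<in> K" using e A unfolding z_def by blast
    have q: "a *\<^sub>R (s *\<^sub>R v + (1 - s) *\<^sub>R x) + (1 - a) *\<^sub>R z \<in> K"
      using convexD[OF K mem zK, of a "1 - a"] a by simp
    have k1: "a * (1 - s) = (1 - a) * (e - 1)"
      using e s1 unfolding a_def by (auto simp: field_simps)
    have "a *\<^sub>R (s *\<^sub>R v + (1 - s) *\<^sub>R x) + (1 - a) *\<^sub>R z
        = (a * s) *\<^sub>R v + (a * (1 - s) + (1 - a) * (1 - e)) *\<^sub>R x + ((1 - a) * e) *\<^sub>R y"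
      unfolding z_def by (simp add: algebra_simps)
    also have "a * (1 - s) + (1 - a) * (1 - e) = 0" using k1 by (simp add: algebra_simps)
    also have "(1 - a) * e = 1 - a * s" using k1 by (simp add: algebra_simps)
    finally have eq: "a *\<^sub>R (s *\<^sub>R v + (1 - s) *\<^sub>R x) + (1 - a) *\<^sub>R z
        = (a * s) *\<^sub>R v + (1 - a * s) *\<^sub>R y" by simp
    have "0 < a * s" "a * s \<le> 1" using a s by (auto simp: mult_le_one)
    then show False using q y(2) unfolding eq visible_from_def by blast
  qed
qed

text \<open>Otherwise a short step from the relative interior point \<open>y\<close> towards
  \<open>v\<close> would stay in \<open>A\<close>. This makes \<open>insert v S\<close> affinely
  independent when \<open>v\<close> sees the simplex on \<open>S\<close>.\<close>

lemma visible_from_not_in_affine_hull: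
  fixes K :: "'a::euclidean_space set"
  assumes A: "A \<subseteq> K" and y: "y \<in> rel_interior A" "visible_from v K y"
  shows "v \<notin> affine hull A"
proof
  assume v: "v \<in> affine hull A"
  obtain e where e: "e > 0" "y \<in> A" "ball y e \<inter> affine hull A \<subseteq> A"
    using y(1) unfolding mem_rel_interior_ball by blast
  \<comment> \<open>The summand 1 in the denominator covers \<open>v = y\<close>; the length of the
    step is then at most \<open>e / 2\<close>.\<close>
  define s where "s = min 1 (e / 2 / (norm (v - y) + 1))"
  have s: "0 < s" "s \<le> 1" using e unfolding s_def by (auto simp: add_nonneg_pos)
  have "s * norm (v - y) \<le> e / 2 / (norm (v - y) + 1) * norm (v - y)"
    unfolding s_def by (intro mult_right_mono) auto
  also have "\<dots> = e / 2 * (norm (v - y) / (norm (v - y) + 1))" by simp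
  also have "\<dots> \<le> e / 2 * 1" using e by (intro mult_left_mono) (auto simp: divide_le_eq add_nonneg_pos)
  finally have "s * norm (v - y) \<le> e / 2" by simp
  also have "\<dots> < e" using e by simp
  finally have lt: "s * norm (v - y) < e" .
  have "y \<in> affine hull A" using e(2) by (simp add: hull_inc)
  then have "s *\<^sub>R v + (1 - s) *\<^sub>R y \<in> affine hull A"
    using v by (intro mem_affine) auto
  moreover have "y - (s *\<^sub>R v + (1 - s) *\<^sub>R y) = s *\<^sub>R (y - v)" by (simp add: algebra_simps)
  then have "dist y (s *\<^sub>R v + (1 - s) *\<^sub>R y) = s * norm (v - y)"
    using s by (simp add: dist_norm norm_minus_commute)
  ultimately have "s *\<^sub>R v + (1 - s) *\<^sub>R y \<in> A" using e lt by auto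
  then show False using y(2) s A unfolding visible_from_def by blast
qed

text \<open>Splitting off the coefficient of \<open>v\<close> and dividing the others by
  \<open>1 - u v\<close> shows the open simplex as an open cone over the one opposite
  \<open>v\<close>. Nonemptiness of \<open>S\<close> keeps \<open>u v\<close> below 1.\<close>

lemma rel_interior_convex_hull_insert:
  fixes S :: "'a::euclidean_space set"
  assumes S: "\<not> affine_dependent S" "S \<noteq> {}" and v: "v \<notin> affine hull S"
  shows "rel_interior (convex hull (insert v S))
    = {s *\<^sub>R v + (1 - s) *\<^sub>R y | s y. 0 < s \<and> s < 1 \<and> y \<in> rel_interior (convex hull S)}"
proof -
  have vS: "v \<notin> S" using v hull_inc by metis
  have fin: "finite S" using S(1) aff_independent_finite by blast
  have ind: "\<not> affine_dependent (insert v S)"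
    using S(1) v affine_independent_insert by blast
  show ?thesis
    unfolding rel_interior_convex_hull_explicit[OF ind] rel_interior_convex_hull_explicit[OF S(1)]
  proof (intro set_eqI iffI; clarsimp simp: fin vS)
    fix u :: "'a \<Rightarrow> real" assume u: "0 < u v" "\<forall>x\<in>S. 0 < u x" and sum: "u v + sum u S = 1"
    define y where "y = (\<Sum>x\<in>S. (u x / (1 - u v)) *\<^sub>R x)"
    have pos: "0 < sum u S" using u S(2) fin by (intro sum_pos) auto
    then have lt: "u v < 1" using sum by linarith
    have "(\<Sum>x\<in>S. u x / (1 - u v)) = 1"
      using sum lt pos unfolding sum_divide_distrib[symmetric] by (simp add: field_simps)
    moreover have "(1 - u v) *\<^sub>R y = (\<Sum>x\<in>S. u x *\<^sub>R x)"
      unfolding y_def using lt by (simp add: scaleR_right.sum)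
    ultimately show "\<exists>s y. u v *\<^sub>R v + (\<Sum>x\<in>S. u x *\<^sub>R x) = s *\<^sub>R v + (1 - s) *\<^sub>R y \<and> 0 < s \<and> s < 1 \<and>
         (\<exists>u. (\<forall>x\<in>S. 0 < u x) \<and> sum u S = 1 \<and> (\<Sum>x\<in>S. u x *\<^sub>R x) = y)"
      using u lt by (intro exI[of _ "u v"] exI[of _ y] conjI exI[of _ "\<lambda>x. u x / (1 - u v)"])
        (auto simp: y_def)
  next
    fix s :: real and u :: "'a \<Rightarrow> real" assume s: "0 < s" "s < 1" and u: "\<forall>x\<in>S. 0 < u x" "sum u S = 1"
    let ?w = "\<lambda>x. if x = v then s else (1 - s) * u x"
    have "(\<Sum>x\<in>S. ?w x) = (\<Sum>x\<in>S. (1 - s) * u x)" "(\<Sum>x\<in>S. ?w x *\<^sub>R x) = (\<Sum>x\<in>S. ((1 - s) * u x) *\<^sub>R x)"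
      using vS by (auto intro!: sum.cong)
    then have "(\<Sum>x\<in>S. ?w x) = 1 - s" "(\<Sum>x\<in>S. ?w x *\<^sub>R x) = (1 - s) *\<^sub>R (\<Sum>x\<in>S. u x *\<^sub>R x)"
      using u by (simp_all add: sum_distrib_left[symmetric] scaleR_right.sum)
    then show "\<exists>w. 0 < w v \<and> (\<forall>x\<in>S. 0 < w x) \<and> w v + sum w S = 1 \<and>
         w v *\<^sub>R v + (\<Sum>x\<in>S. w x *\<^sub>R x) = s *\<^sub>R v + (1 - s) *\<^sub>R (\<Sum>x\<in>S. u x *\<^sub>R x)"
      using s u by (intro exI[of _ ?w]) auto
  qed
qed

text \<open>Of two base points on one ray through \<open>v\<close>, the one nearer to
  \<open>v\<close> would block the other. Cones over disjoint visible simplices are therefore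
  disjoint.\<close>

lemma visible_from_same_ray:
  assumes K: "convex K" and y: "visible_from v K y" "visible_from v K y'"
    and s: "0 < s" "s < 1" "0 < s'" "s' < 1"
    and eq: "s *\<^sub>R v + (1 - s) *\<^sub>R y = s' *\<^sub>R v + (1 - s') *\<^sub>R y'"
  shows "y = y'"
proof -
  have aux: "\<not> s < s'" if y: "visible_from v K y" "visible_from v K y'"
    and s: "0 < s" "s < 1" "0 < s'" "s' < 1"
    and eq: "s *\<^sub>R v + (1 - s) *\<^sub>R y = s' *\<^sub>R v + (1 - s') *\<^sub>R y'" for s s' y y'
  proof
    assume lt: "s < s'"
    define r where "r = (s' - s) / (1 - s)"
    have r: "0 < r" "r \<le> 1" "(1 - s) * r = s' - s" "(1 - s) * (1 - r) = 1 - s'"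
      unfolding r_def using s lt by (auto simp: field_simps)
    have "(1 - s) *\<^sub>R y = (s' - s) *\<^sub>R v + (1 - s') *\<^sub>R y'" using eq by (simp add: algebra_simps)
    also have "\<dots> = (1 - s) *\<^sub>R (r *\<^sub>R v + (1 - r) *\<^sub>R y')"
      unfolding r(3,4)[symmetric] by (simp add: scaleR_add_right)
    finally have "y = r *\<^sub>R v + (1 - r) *\<^sub>R y'" using s by simp
    then show False using y r unfolding visible_from_def by blast
  qed
  have "s = s'" using aux[OF y s eq] aux[OF y(2,1) s(3,4,1,2) eq[symmetric]] by simp
  then show ?thesis using eq s by simp
qed

text \<open>
  Vertices are added one at a time; a new vertex \<open>v\<close> outside the current hull is joined to
  exactly those open simplices that it sees.
\<close>

lemma convex_hull_open_simplices:
  fixes V :: "'a::euclidean_space set"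
  assumes "finite V"
  obtains T where "\<And>S. S \<in> T \<Longrightarrow> S \<subseteq> V \<and> S \<noteq> {} \<and> \<not> affine_dependent S"
    "disjoint_family_on (\<lambda>S. rel_interior (convex hull S)) T"
    "(\<Union>S\<in>T. rel_interior (convex hull S)) = convex hull V"
  using assms
proof (induction V arbitrary: thesis rule: finite_induct)
  case empty
  show ?case by (rule empty[of "{}"]) (auto simp: disjoint_family_on_def)
next
  case (insert v W)
  let ?o = "\<lambda>S. rel_interior (convex hull S)"
  let ?K = "convex hull W"
  obtain T where T: "\<And>S. S \<in> T \<Longrightarrow> S \<subseteq> W \<and> S \<noteq> {} \<and> \<not> affine_dependent S"
    and Td: "disjoint_family_on ?o T" and TU: "(\<Union>S\<in>T. ?o S) = ?K"
    using insert.IH by blast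
  show ?case
  proof (cases "v \<in> ?K")
    case True
    then have "convex hull (insert v W) = ?K" by (simp add: hull_redundant)
    then show ?thesis using insert.prems[of T] T Td TU by auto
  next
    case v: False
    \<comment> \<open>One visible point suffices here, since visibility then extends to the whole
      simplex.\<close>
    define N where "N = {S \<in> T. \<exists>y \<in> ?o S. visible_from v ?K y}"
    have sub: "convex hull S \<subseteq> ?K" if "S \<in> T" for S using T[OF that] by (simp add: hull_mono)
    have vis: "visible_from v ?K y" if "S \<in> N" "y \<in> ?o S" for S y
      using that sub visible_from_rel_interior[of ?K "convex hull S"] rel_interior_subset
      unfolding N_def by blast
    have naff: "v \<notin> affine hull S" if "S \<in> N" for S
      using that sub visible_from_not_in_affine_hull[of "convex hull S" ?K]
      unfolding N_def affine_hull_convex_hull by blast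
    have ins: "?o (insert v S) = {s *\<^sub>R v + (1 - s) *\<^sub>R y | s y. 0 < s \<and> s < 1 \<and> y \<in> ?o S}"
      if "S \<in> N" for S
      using that T naff unfolding N_def by (intro rel_interior_convex_hull_insert) auto
    have outside: "x \<notin> ?K" if "S \<in> N" "x \<in> ?o (insert v S)" for S x
      using that vis unfolding ins[OF that(1)] visible_from_def by fastforce
    have notv: "x \<noteq> v" if S: "S \<in> N" and x: "x \<in> ?o (insert v S)" for S x
    proof
      assume "x = v"
      then obtain s y where sy: "v = s *\<^sub>R v + (1 - s) *\<^sub>R y" "0 < s" "s < 1" "y \<in> ?o S"
        using x unfolding ins[OF S] by blast
      then have "(1 - s) *\<^sub>R v = (1 - s) *\<^sub>R y" by (simp add: algebra_simps)
      then have "v = y" using sy by simp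
      then show False using v vis[OF S sy(4)] unfolding visible_from_def by blast
    qed
    have same: "S = S'" if S: "S \<in> N" "S' \<in> N" and x: "x \<in> ?o (insert v S)" "x \<in> ?o (insert v S')" for S S' x
    proof -
      obtain s y where sy: "x = s *\<^sub>R v + (1 - s) *\<^sub>R y" "0 < s" "s < 1" "y \<in> ?o S"
        using x unfolding ins[OF S(1)] by blast
      obtain s' y' where sy': "x = s' *\<^sub>R v + (1 - s') *\<^sub>R y'" "0 < s'" "s' < 1" "y' \<in> ?o S'"
        using x unfolding ins[OF S(2)] by blast
      have "y = y'"
        using visible_from_same_ray[of ?K v y y' s s'] vis[OF S(1) sy(4)] vis[OF S(2) sy'(4)] sy sy'
        by auto
      then show ?thesis using Td S sy(4) sy'(4) unfolding disjoint_family_on_def N_def by blast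
    qed
    have inK: "x \<in> ?K" if "S \<in> T" "x \<in> ?o S" for S x using TU that by blast
    \<comment> \<open>The singleton \<open>{v}\<close> plays the role of the cone over the empty
      simplex, which \<open>T\<close> does not contain.\<close>
    let ?T = "insert {v} (T \<union> insert v ` N)"
    show ?thesis
    proof (rule insert.prems[of ?T])
      show "S \<subseteq> insert v W \<and> S \<noteq> {} \<and> \<not> affine_dependent S" if S: "S \<in> ?T" for S
      proof -
        consider "S = {v}" | "S \<in> T" | S' where "S' \<in> N" "S = insert v S'" using S by blast
        then show ?thesis
        proof cases
          case 3
          then have "S' \<in> T" unfolding N_def by blast
          then show ?thesis using 3 T naff[OF 3(1)] affine_independent_insert by blast
        qed (use T in auto)
      qed
      show "disjoint_family_on ?o ?T"
        unfolding disjoint_family_on_def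
      proof (intro ballI impI)
        fix R R' assume R: "R \<in> ?T" "R' \<in> ?T" "R \<noteq> R'"
        have R1: "R = {v} \<or> R \<in> T \<or> (\<exists>S\<in>N. R = insert v S)" using R(1) by blast
        have R2: "R' = {v} \<or> R' \<in> T \<or> (\<exists>S\<in>N. R' = insert v S)" using R(2) by blast
        have ov: "?o {v} = {v}" by simp
        show "?o R \<inter> ?o R' = {}"
        proof (rule ccontr)
          assume "\<not> ?thesis"
          then obtain x where x: "x \<in> ?o R" "x \<in> ?o R'" by blast
          show False
            using R1
          proof (elim disjE bexE)
            assume R1: "R = {v}"
            then have xv: "x = v" using x ov by simp
            show False using R2 R(3) R1 xv x v inK notv by blast
          next
            assume R1: "R \<in> T"
            then have xK: "x \<in> ?K" using x inK by blast
            then have "x \<noteq> v" using v by blast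
            then have "R' \<noteq> {v}" using ov x by blast
            moreover have "R' \<notin> T" using Td R1 R(3) x unfolding disjoint_family_on_def by blast
            ultimately show False using R2 xK outside x by blast
          next
            fix S assume S: "S \<in> N" "R = insert v S"
            then have "x \<noteq> v" "x \<notin> ?K" using notv outside x by blast+
            then have "R' \<noteq> {v}" "R' \<notin> T" using ov x inK by blast+
            then obtain S' where S': "S' \<in> N" "R' = insert v S'" using R2 by blast
            then show False using same[OF S(1) S'(1)] S x R(3) by blast
          qed
        qed
      qed
      show "(\<Union>S\<in>?T. ?o S) = convex hull insert v W"
      proof
        have "?o S \<subseteq> convex hull insert v W" if "S \<subseteq> insert v W" for S
          using rel_interior_subset hull_mono[OF that, of convex] by blast
        moreover have "S \<subseteq> insert v W" if "S \<in> ?T" for S using that T unfolding N_def by blast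
        ultimately show "(\<Union>S\<in>?T. ?o S) \<subseteq> convex hull insert v W" by blast
        show "convex hull insert v W \<subseteq> (\<Union>S\<in>?T. ?o S)"
        proof
          fix x assume x: "x \<in> convex hull insert v W"
          show "x \<in> (\<Union>S\<in>?T. ?o S)"
          proof (cases "x = v \<or> x \<in> ?K")
            case True
            then show ?thesis
            proof
              assume "x = v"
              then show ?thesis by simp
            qed (use TU in blast)
          next
            case False
            then have "W \<noteq> {}" using x by auto
            then obtain u0 z where z: "z \<in> ?K" "x = (1 - u0) *\<^sub>R v + u0 *\<^sub>R z" "0 \<le> u0" "u0 \<le> 1"
              using x unfolding convex_hull_insert_alt by auto
            \<comment> \<open>The point of \<open>K\<close> on the segment that is nearest to
              \<open>v\<close> is visible; \<open>x\<close> will lie strictly between it and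
              \<open>v\<close>.\<close>
            let ?C = "closed_segment z v \<inter> ?K"
            have "closed ?C" using compact_imp_closed finite_imp_compact_convex_hull[OF insert.hyps(1)]
              by (intro closed_Int) auto
            moreover have "?C \<noteq> {}" using z by auto
            ultimately obtain y where y: "y \<in> ?C" "\<And>w. w \<in> ?C \<Longrightarrow> dist v y \<le> dist v w"
              using distance_attains_inf by blast
            have yv: "y \<noteq> v" using y(1) v by blast
            have visy: "visible_from v ?K y"
              unfolding visible_from_def
            proof (intro conjI allI impI notI)
              show "y \<in> ?K" using y by blast
              fix s :: real assume s: "0 < s \<and> s \<le> 1" and m: "s *\<^sub>R v + (1 - s) *\<^sub>R y \<in> ?K"
              have "v \<in> closed_segment z v" "y \<in> closed_segment z v" using y by auto
              then have "s *\<^sub>R v + (1 - s) *\<^sub>R y \<in> closed_segment z v"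
                using s convexD[OF convex_closed_segment, of v z v y s "1 - s"] by auto
              then have "dist v y \<le> dist v (s *\<^sub>R v + (1 - s) *\<^sub>R y)" using y m by blast
              also have "v - (s *\<^sub>R v + (1 - s) *\<^sub>R y) = (1 - s) *\<^sub>R (v - y)" by (simp add: algebra_simps)
              then have "dist v (s *\<^sub>R v + (1 - s) *\<^sub>R y) = (1 - s) * dist v y"
                using s by (simp add: dist_norm)
              finally have "s * dist v y \<le> 0" by (simp add: algebra_simps)
              then show False using s yv by (simp add: mult_le_0_iff)
            qed
            obtain t where t: "0 \<le> t" "t \<le> 1" "y = (1 - t) *\<^sub>R z + t *\<^sub>R v"
              using y(1) unfolding closed_segment_def by blast
            have t1: "t < 1" using t yv by (cases "t = 1") auto
            have lt: "t < 1 - u0"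
            proof (rule ccontr)
              assume "\<not> t < 1 - u0"
              then have le: "1 - u0 \<le> t" by simp
              \<comment> \<open>This places \<open>x\<close> on the segment from \<open>z\<close> to
                \<open>y\<close>, hence in \<open>K\<close>. If \<open>t = 0\<close>, then
                \<open>u0 = 1\<close> and \<open>x = z\<close>.\<close>
              define r where "r = (if t = 0 then 0 else (1 - u0) / t)"
              have r: "0 \<le> r" "r \<le> 1" "r * t = 1 - u0"
                unfolding r_def using le t z by (auto simp: field_simps)
              have "r *\<^sub>R y + (1 - r) *\<^sub>R z = (r * t) *\<^sub>R v + (1 - r * t) *\<^sub>R z"
                unfolding t(3) by (simp add: algebra_simps)
              also have "\<dots> = x" unfolding r(3) z(2) by simp
              finally have "x \<in> ?K" using convexD[OF convex_convex_hull, of y W z r "1 - r"] y z r by auto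
              then show False using False by blast
            qed
            \<comment> \<open>Found by comparing the coefficients of \<open>z\<close> in the
              expressions of \<open>x\<close> through \<open>z\<close>, \<open>v\<close> and through
              \<open>y\<close>, \<open>v\<close>.\<close>
            define s where "s = (1 - u0 - t) / (1 - t)"
            have u0: "u0 \<noteq> 0" using False z by auto
            have s: "0 < s" "s < 1" using lt t1 z u0 unfolding s_def by (auto simp: field_simps)
            have e1: "s + (1 - s) * t = 1 - u0" "(1 - s) * (1 - t) = u0"
              unfolding s_def using t1 by (auto simp: divide_simps) (simp add: algebra_simps)+
            have "s *\<^sub>R v + (1 - s) *\<^sub>R y = (s + (1 - s) * t) *\<^sub>R v + ((1 - s) * (1 - t)) *\<^sub>R z"
              unfolding t(3) by (simp add: algebra_simps)
            then have xs: "x = s *\<^sub>R v + (1 - s) *\<^sub>R y" unfolding e1 z(2) by simp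
            obtain S where S: "S \<in> T" "y \<in> ?o S" using TU y(1) by blast
            then have "S \<in> N" unfolding N_def using visy by blast
            then have "x \<in> ?o (insert v S)" unfolding ins[OF \<open>S \<in> N\<close>] using xs s S by blast
            then show ?thesis using \<open>S \<in> N\<close> by blast
          qed
        qed
      qed
    qed
  qed
qed

text \<open>A relative frontier point lies in a proper face, and a face that contains a relative
  interior point of a simplex inside \<open>C\<close> contains the whole simplex. Each open simplex
  thus lies in the relative interior of \<open>C\<close> or misses it, and it is enough to keep the
  former.\<close>

lemma rel_interior_polytope_open_simplices:
  fixes C :: "'a::euclidean_space set"
  assumes C: "polytope C"
  obtains T where "finite T"
    "\<And>S. S \<in> T \<Longrightarrow> S \<subseteq> {v. v extreme_point_of C} \<and> S \<noteq> {} \<and> \<not> affine_dependent S"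
    "disjoint_family_on (\<lambda>S. rel_interior (convex hull S)) T"
    "(\<Union>S\<in>T. rel_interior (convex hull S)) = rel_interior C"
proof -
  let ?o = "\<lambda>S. rel_interior (convex hull S)"
  define V where "V = {v. v extreme_point_of C}"
  have poly: "polyhedron C" using C by (rule polytope_imp_polyhedron)
  have fin: "finite V" unfolding V_def using finite_polyhedron_extreme_points[OF poly] .
  have CV: "C = convex hull V" unfolding V_def
    using C by (intro Krein_Milman_Minkowski) (auto simp: polytope_imp_compact polytope_imp_convex)
  obtain T where T: "\<And>S. S \<in> T \<Longrightarrow> S \<subseteq> V \<and> S \<noteq> {} \<and> \<not> affine_dependent S"
    and Td: "disjoint_family_on ?o T" and TU: "(\<Union>S\<in>T. ?o S) = C"
    using convex_hull_open_simplices[OF fin] unfolding CV[symmetric] by metis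
  define T' where "T' = {S \<in> T. ?o S \<subseteq> rel_interior C}"
  have dich: "?o S \<subseteq> rel_interior C" if S: "S \<in> T" and x: "x \<in> ?o S" "x \<in> rel_interior C" for S x
  proof
    fix y assume y: "y \<in> ?o S"
    have sub: "convex hull S \<subseteq> C" unfolding CV using T[OF S] by (simp add: hull_mono)
    show "y \<in> rel_interior C"
    proof (rule ccontr)
      assume n: "y \<notin> rel_interior C"
      have "y \<in> C" using y sub rel_interior_subset by blast
      then have "y \<in> rel_frontier C"
        using n closure_subset unfolding rel_frontier_def by blast
      then obtain F where F: "F face_of C" "F \<noteq> C" "y \<in> F"
        unfolding rel_frontier_of_polyhedron_alt[OF poly] by blast
      have "convex hull S \<subseteq> F" using subset_of_face_of[OF F(1) sub] F(3) y by blast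
      then have "x \<in> F" using x rel_interior_subset by blast
      then show False using face_of_disjoint_rel_interior[OF F(1,2)] x by blast
    qed
  qed
  have "T \<subseteq> Pow V" using T by blast
  then have "finite T" using fin finite_subset by blast
  then have "finite T'" unfolding T'_def by simp
  moreover have "(\<Union>S\<in>T'. ?o S) = rel_interior C"
  proof
    show "rel_interior C \<subseteq> (\<Union>S\<in>T'. ?o S)"
    proof
      fix x assume x: "x \<in> rel_interior C"
      then have "x \<in> (\<Union>S\<in>T. ?o S)" using TU rel_interior_subset[of C] by blast
      then obtain S where S: "S \<in> T" "x \<in> ?o S" by blast
      then have "S \<in> T'" unfolding T'_def using dich[OF S x] by blast
      then show "x \<in> (\<Union>S\<in>T'. ?o S)" using S(2) by blast
    qed
  qed (auto simp: T'_def)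
  moreover have "disjoint_family_on ?o T'"
    using Td unfolding disjoint_family_on_def T'_def by blast
  ultimately show thesis
    by (intro that[of T']) (use T in \<open>auto simp: T'_def V_def\<close>)
qed

text \<open>By Baire, removing finitely many affine subspaces of smaller dimension from the affine
  hull of \<open>C\<close> leaves a dense set, which meets the relative interior of
  \<open>C\<close>.\<close>

lemma convex_subset_Union_aff_dim:
  fixes C :: "'a::euclidean_space set"
  assumes C: "convex C" "C \<noteq> {}" and A: "finite A" and sub: "rel_interior C \<subseteq> (\<Union>S\<in>A. f S)"
  shows "\<exists>S\<in>A. aff_dim C \<le> aff_dim (f S)"
proof (rule ccontr)
  assume "\<not> ?thesis"
  then have lt: "aff_dim (f S) < aff_dim C" if "S \<in> A" for S using that by force
  let ?H = "affine hull C"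
  let ?G = "(\<lambda>S. ?H - affine hull (f S)) ` A"
  have "?H \<subseteq> closure (\<Inter>?G)"
  proof (rule Baire)
    show "countable ?G" using A by (simp add: countable_finite)
    fix T assume "T \<in> ?G"
    then obtain S where S: "S \<in> A" "T = ?H - affine hull (f S)" by blast
    have "aff_dim (affine hull (f S)) < aff_dim ?H" using lt[OF S(1)] by simp
    then have "closure T = ?H" unfolding S(2) by (intro dense_complement_affine) auto
    moreover have "T = ?H \<inter> - (affine hull (f S))" unfolding S(2) by (rule Diff_eq)
    then have "openin (top_of_set ?H) T" by (simp add: openin_open_Int open_Compl)
    ultimately show "openin (top_of_set ?H) T \<and> ?H \<subseteq> closure T" by simp
  qed simp
  obtain x where x: "x \<in> rel_interior C" using C rel_interior_eq_empty by blast
  then obtain e where e: "e > 0" "ball x e \<inter> ?H \<subseteq> rel_interior C"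
    using openin_rel_interior[of C] unfolding openin_contains_ball by blast
  have "x \<in> ?H" using x rel_interior_subset hull_inc by (metis subsetD)
  then have "x \<in> closure (\<Inter>?G)" using \<open>?H \<subseteq> closure (\<Inter>?G)\<close> by blast
  then obtain y where y: "y \<in> \<Inter>?G" "dist y x < e"
    using e(1) unfolding closure_approachable by blast
  have "A \<noteq> {}" using x sub by blast
  then have "y \<in> ?H" using y by blast
  then have "y \<in> rel_interior C" using y e by (auto simp: dist_commute)
  then obtain S where "S \<in> A" "y \<in> f S" using sub by blast
  moreover have "f S \<subseteq> affine hull (f S)" by (rule hull_subset)
  ultimately show False using y(1) by blast
qed

section \<open>Lattice points in dilated open simplices\<close>

text \<open>Stars and bars, transferred from lists along an enumeration of \<open>S\<close>.
  Truncated subtraction also gives the right value for empty \<open>S\<close>: 1 if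
  \<open>N = 0\<close>, else 0.\<close>

lemma card_nat_functions_sum:
  assumes "finite S"
  shows "finite {n \<in> S \<rightarrow>\<^sub>E (UNIV :: nat set). sum n S = N}"
    and "card {n \<in> S \<rightarrow>\<^sub>E (UNIV :: nat set). sum n S = N} = (N + card S - 1) choose N"
proof -
  let ?A = "{n \<in> S \<rightarrow>\<^sub>E (UNIV :: nat set). sum n S = N}"
  let ?B = "{l :: nat list. length l = card S \<and> sum_list l = N}"
  obtain xs where xs: "distinct xs" "set xs = S" using finite_distinct_list[OF assms] by blast
  have len: "length xs = card S" using distinct_card[OF xs(1)] xs(2) by simp
  have bij: "bij_betw (\<lambda>n. map n xs) ?A ?B"
  proof (rule bij_betw_imageI)
    show "inj_on (\<lambda>n. map n xs) ?A"
    proof (rule inj_onI)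
      fix n n' assume n: "n \<in> ?A" "n' \<in> ?A" "map n xs = map n' xs"
      then have "\<forall>x\<in>S. n x = n' x" using xs(2) by (simp add: map_eq_conv)
      then show "n = n'" using n PiE_ext[of n S "\<lambda>_. UNIV" n'] by auto
    qed
    show "(\<lambda>n. map n xs) ` ?A = ?B"
    proof
      show "(\<lambda>n. map n xs) ` ?A \<subseteq> ?B"
        using xs len by (auto simp: sum_list_distinct_conv_sum_set)
      show "?B \<subseteq> (\<lambda>n. map n xs) ` ?A"
      proof
        fix l assume l: "l \<in> ?B"
        define n where "n = (\<lambda>x\<in>S. the (map_of (zip xs l) x))"
        have "map n xs = l"
        proof (rule nth_equalityI)
          fix i assume "i < length (map n xs)"
          then show "map n xs ! i = l ! i"
            using xs l len unfolding n_def by (auto simp: map_of_zip_nth)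
        qed (use l len in auto)
        moreover have "sum n S = N"
          using calculation l xs sum_list_distinct_conv_sum_set[of xs n] by simp
        moreover have "n \<in> S \<rightarrow>\<^sub>E UNIV" unfolding n_def by auto
        ultimately show "l \<in> (\<lambda>n. map n xs) ` ?A" by blast
      qed
    qed
  qed
  have "?B \<subseteq> {l. set l \<subseteq> {..N} \<and> length l = card S}"
    using member_le_sum_list by fastforce
  then have "finite ?B" using finite_lists_length_eq[of "{..N}" "card S"] finite_subset by blast
  then show "finite ?A" using bij_betw_finite[OF bij] by simp
  show "card ?A = (N + card S - 1) choose N"
    using bij_betw_same_card[OF bij] card_length_sum_list[of "card S" N] by simp
qed

text \<open>The binomial coefficient \<open>X + m - h choose m\<close> as a polynomial in X. At
  \<open>k >= h\<close> it counts the vectors of \<open>m + 1\<close> natural numbers with sum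
  \<open>k - h\<close>.\<close>

definition shifted_binomial_poly :: "nat \<Rightarrow> nat \<Rightarrow> real poly" where
  "shifted_binomial_poly m h = smult (1 / fact m) (\<Prod>i=0..<m. [:real m - real h - real i, 1:])"

lemma poly_shifted_binomial_poly:
  assumes "h \<le> k + m"
  shows "poly (shifted_binomial_poly m h) (real k) = real ((k + m - h) choose m)"
proof -
  have "poly [:real m - real h - real i, 1:] (real k) = real (k + m - h) - real i" for i
    using assms by (simp add: of_nat_diff)
  then have "poly (shifted_binomial_poly m h) (real k) = (real (k + m - h)) gchoose m"
    unfolding shifted_binomial_poly_def gbinomial_prod_rev poly_smult poly_prod by (simp only:) simp
  then show ?thesis by (simp add: binomial_gbinomial)
qed

lemma degree_shifted_binomial_poly: "degree (shifted_binomial_poly m h) = m"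
proof -
  have "degree (\<Prod>i=0..<m. [:real m - real h - real i, 1:])
      = (\<Sum>i=0..<m. degree [:real m - real h - real i, 1:])"
    by (intro degree_prod_eq_sum_degree) auto
  then show ?thesis unfolding shifted_binomial_poly_def by simp
qed

lemma coeff_shifted_binomial_poly: "coeff (shifted_binomial_poly m h) m > 0"
proof -
  have "lead_coeff (shifted_binomial_poly m h) = 1 / fact m"
    unfolding shifted_binomial_poly_def by (simp add: lead_coeff_prod)
  then show ?thesis by (simp add: degree_shifted_binomial_poly)
qed

section \<open>Lattice points and coordinates with respect to affinely independent points\<close>

lemma finite_integer_points_bounded:
  assumes "bounded (B :: (real ^ 'd) set)"
  shows "finite (B \<inter> integer_points)"
proof -
  obtain R where R: "\<And>x. x \<in> B \<Longrightarrow> norm x \<le> R" using assms unfolding bounded_iff by blast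
  let ?I = "{k \<in> \<int>. - R \<le> k \<and> k \<le> R} :: real set"
  have "vec_nth ` (B \<inter> integer_points) \<subseteq> (UNIV \<rightarrow>\<^sub>E ?I)"
  proof
    fix f assume "f \<in> vec_nth ` (B \<inter> integer_points)"
    then obtain x where x: "x \<in> B" "x \<in> integer_points" "f = vec_nth x" by blast
    have "\<bar>x $ i\<bar> \<le> R" for i using component_le_norm_cart[of x i] R[OF x(1)] by linarith
    then have "- R \<le> x $ i \<and> x $ i \<le> R" for i by (simp add: abs_le_iff minus_le_iff)
    then show "f \<in> UNIV \<rightarrow>\<^sub>E ?I" using x unfolding integer_points_def by auto
  qed
  moreover have "finite (UNIV \<rightarrow>\<^sub>E ?I :: ('d \<Rightarrow> real) set)"
    by (intro finite_PiE finite_int_segment) auto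
  ultimately have "finite (vec_nth ` (B \<inter> integer_points))" using finite_subset by blast
  moreover have "inj vec_nth" by (simp add: inj_def vec_nth_inject)
  ultimately show ?thesis using finite_imageD inj_on_subset by blast
qed

lemma integer_points_sum_scaleR:
  assumes "\<And>v. v \<in> S \<Longrightarrow> n v \<in> \<int>" "S \<subseteq> integer_points"
  shows "(\<Sum>v\<in>S. n v *\<^sub>R v) \<in> integer_points"
  using assms unfolding integer_points_def by (auto simp: sum_component intro!: Ints_sum Ints_mult)

lemma integer_points_add: "x \<in> integer_points \<Longrightarrow> y \<in> integer_points \<Longrightarrow> x + y \<in> integer_points"
  and integer_points_diff: "x \<in> integer_points \<Longrightarrow> y \<in> integer_points \<Longrightarrow> x - y \<in> integer_points"
  unfolding integer_points_def by (simp_all add: Ints_add Ints_diff)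

lemma affine_independent_coefficients_unique:
  fixes S :: "'a::euclidean_space set"
  assumes S: "\<not> affine_dependent S" and c: "c \<in> S \<rightarrow>\<^sub>E A" "c' \<in> S \<rightarrow>\<^sub>E A'"
    and eq: "sum c S = sum c' S" "(\<Sum>v\<in>S. c v *\<^sub>R v) = (\<Sum>v\<in>S. c' v *\<^sub>R v)"
  shows "c = c'"
proof -
  have fin: "finite S" using S aff_independent_finite by blast
  let ?U = "\<lambda>v. c v - c' v"
  have "sum ?U S = 0" "(\<Sum>v\<in>S. ?U v *\<^sub>R v) = 0"
    using eq by (auto simp: sum_subtractf scaleR_left_diff_distrib)
  then have "\<forall>v\<in>S. ?U v = 0" using S unfolding affine_dependent_explicit_finite[OF fin] by blast
  then have "c v = c' v" for v
    using c by (cases "v \<in> S") (auto simp: PiE_def extensional_def)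
  then show ?thesis by blast
qed

text \<open>
  Splitting each positive coefficient \<open>c\<close> as \<open>a + n\<close> with \<open>a \<in> (0, 1]\<close> and \<open>n\<close> a natural number
  reduces the lattice points of all dilates to those of one half-open parallelepiped over the
  simplex; this holds for all \<open>k > 0\<close> because the heights \<open>h\<close> of the latter are at most \<open>card S\<close>.
\<close>

lemma open_simplex_lattice_count:
  fixes S :: "(real ^ 'd) set"
  assumes S: "\<not> affine_dependent S" "S \<noteq> {}" "S \<subseteq> integer_points"
  obtains p :: "real poly" where "degree p + 1 = card S" "coeff p (degree p) > 0"
    "\<And>k::nat. k > 0 \<Longrightarrow>
      finite ((\<lambda>x. real k *\<^sub>R x) ` rel_interior (convex hull S) \<inter> integer_points) \<and>
      real (card ((\<lambda>x. real k *\<^sub>R x) ` rel_interior (convex hull S) \<inter> integer_points))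
        = poly p (real k)"
proof -
  have fin: "finite S" using S(1) aff_independent_finite by blast
  define m where "m = card S - 1"
  have card: "card S = m + 1" using S(2) fin unfolding m_def by (simp add: card_gt_0_iff Suc_leI)
  define comb where "comb c = (\<Sum>v\<in>S. c v *\<^sub>R v)" for c :: "real ^ 'd \<Rightarrow> real"
  \<comment> \<open>With \<open>S\<close> placed at height 1 in one more dimension,
    \<open>comb a\<close> is the position and \<open>sum a S\<close> the height of a point; both
    must be integral. The value 0 is left out because the coefficients of points in an open simplex
    are positive.\<close>
  define L where "L = {a \<in> S \<rightarrow>\<^sub>E {0<..1}. sum a S \<in> \<int> \<and> comb a \<in> integer_points}"
  define h where "h a = nat \<lfloor>sum a S\<rfloor>" for a :: "real ^ 'd \<Rightarrow> real"
  have h: "real (h a) = sum a S" "1 \<le> h a" "h a \<le> m + 1" if "a \<in> L" for a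
  proof -
    have a: "\<forall>v\<in>S. 0 < a v \<and> a v \<le> 1" "sum a S \<in> \<int>" using that unfolding L_def by auto
    have pos: "0 < sum a S" using a fin S(2) by (intro sum_pos) auto
    have le: "sum a S \<le> real (card S)" using a sum_bounded_above[of S a 1] by simp
    show eq: "real (h a) = sum a S" using pos a(2) unfolding h_def by (auto elim!: Ints_cases)
    show "1 \<le> h a" "h a \<le> m + 1" using eq pos le card by linarith+
  qed
  have "inj_on (\<lambda>a. (sum a S, comb a)) L"
    unfolding inj_on_def L_def comb_def using affine_independent_coefficients_unique[OF S(1)] by blast
  moreover have "(\<lambda>a. (sum a S, comb a)) ` L
      \<subseteq> real ` {..m + 1} \<times> (cball 0 (\<Sum>v\<in>S. norm v) \<inter> integer_points)"
  proof (rule image_subsetI)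
    fix a assume a: "a \<in> L"
    have "norm (comb a) \<le> (\<Sum>v\<in>S. norm (a v *\<^sub>R v))" unfolding comb_def by (rule norm_sum)
    also have "\<dots> \<le> (\<Sum>v\<in>S. norm v)"
      using a unfolding L_def by (intro sum_mono) (auto simp: PiE_def Pi_def intro!: mult_left_le_one_le)
    finally show "(sum a S, comb a) \<in> real ` {..m + 1} \<times> (cball 0 (\<Sum>v\<in>S. norm v) \<inter> integer_points)"
      using h[OF a] a unfolding L_def by (auto intro!: image_eqI[of _ _ "h a"])
  qed
  moreover have "finite (real ` {..m + 1} \<times> (cball (0 :: real ^ 'd) (\<Sum>v\<in>S. norm v) \<inter> integer_points))"
    using finite_integer_points_bounded[OF bounded_cball] by blast
  ultimately have finL: "finite L" using finite_imageD finite_subset by meson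
  \<comment> \<open>The sum of all vertices is always available, with the largest height
    \<open>m + 1\<close>. It prevents \<open>p\<close> from being an empty sum.\<close>
  have "restrict (\<lambda>_. 1) S \<in> L"
    using integer_points_sum_scaleR[of S "\<lambda>_. 1"] S(3) unfolding L_def comb_def by auto
  then have L: "L \<noteq> {}" by blast
  define p where "p = (\<Sum>a\<in>L. shifted_binomial_poly m (h a))"
  have pos: "coeff p m > 0"
    unfolding p_def coeff_sum using finL L coeff_shifted_binomial_poly by (intro sum_pos) auto
  have "degree p \<le> m"
    unfolding p_def using finL by (intro degree_sum_le) (auto simp: degree_shifted_binomial_poly)
  then have deg: "degree p = m" using pos le_degree[of p m] by simp
  have count: "finite ((\<lambda>x. real k *\<^sub>R x) ` rel_interior (convex hull S) \<inter> integer_points) \<and>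
      real (card ((\<lambda>x. real k *\<^sub>R x) ` rel_interior (convex hull S) \<inter> integer_points)) = poly p (real k)"
    (is "finite ?X \<and> _") if k: "k > 0" for k :: nat
  proof -
    define M where "M a = {n \<in> S \<rightarrow>\<^sub>E (UNIV :: nat set). h a + sum n S = k}" for a
    have M: "finite (M a) \<and> card (M a) = (k + m - h a) choose m" if "a \<in> L" for a
    proof (cases "h a \<le> k")
      case True
      then have "M a = {n \<in> S \<rightarrow>\<^sub>E UNIV. sum n S = k - h a}" unfolding M_def by auto
      moreover have "(k - h a + m) choose (k - h a) = (k + m - h a) choose m"
        using True binomial_symmetric[of m "k - h a + m"] by simp
      ultimately show ?thesis using card_nat_functions_sum[OF fin, of "k - h a"] card by simp
    next
      case False
      then have "M a = {}" unfolding M_def by auto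
      \<comment> \<open>No truncation takes place: \<open>h a <= m + 1\<close> and
        \<open>k >= 1\<close>. So the binomial coefficient vanishes, as the empty \<open>M a\<close>
        requires.\<close>
      moreover have "k + m - h a < m" using False h[OF that] k by linarith
      ultimately show ?thesis by simp
    qed
    define g where "g = (\<lambda>(a, n). comb (\<lambda>v. a v + real (n v)) :: real ^ 'd)"
    have natcomb: "(\<Sum>v\<in>S. real (n v) *\<^sub>R v) \<in> integer_points" for n :: "real ^ 'd \<Rightarrow> nat"
      by (rule integer_points_sum_scaleR) (use S(3) in auto)
    have sums: "(\<Sum>v\<in>S. a v + real (n v)) = real k" if "a \<in> L" "n \<in> M a" for a n
      using h(1)[OF that(1)] that(2) unfolding M_def by (auto simp: sum.distrib)
    have comb_restrict: "comb (restrict c S) = comb c" "sum (restrict c S) S = sum c S" for c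
      unfolding comb_def by (auto intro!: sum.cong)
    have inj: "inj_on g (Sigma L M)"
    proof (rule inj_onI, clarify)
      fix a n a' n' assume A: "a \<in> L" "n \<in> M a" "a' \<in> L" "n' \<in> M a'" and eq: "g (a, n) = g (a', n')"
      let ?c = "\<lambda>v. a v + real (n v)" and ?c' = "\<lambda>v. a' v + real (n' v)"
      have eq': "restrict ?c S = restrict ?c' S"
      proof (rule affine_independent_coefficients_unique[OF S(1), of _ UNIV _ UNIV])
        show "sum (restrict ?c S) S = sum (restrict ?c' S) S"
          unfolding comb_restrict using sums[OF A(1,2)] sums[OF A(3,4)] by simp
        show "(\<Sum>v\<in>S. restrict ?c S v *\<^sub>R v) = (\<Sum>v\<in>S. restrict ?c' S v *\<^sub>R v)"
          using eq unfolding comb_def[symmetric] comb_restrict g_def by simp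
      qed auto
      have e: "a v + real (n v) = a' v + real (n' v)" if "v \<in> S" for v
        using fun_cong[OF eq', of v] unfolding restrict_apply'[OF that] .
      have both: "n v = n' v \<and> a v = a' v" if "v \<in> S" for v
      proof -
        have "0 < a v" "a v \<le> 1" "0 < a' v" "a' v \<le> 1" using A that unfolding L_def by auto
        then have "real (n v) < real (n' v) + 1" "real (n' v) < real (n v) + 1"
          using e[OF that] by linarith+
        then have "n v = n' v" by linarith
        then show ?thesis using e[OF that] by simp
      qed
      have "a = a'" using A both unfolding L_def by (intro PiE_ext[of a S "\<lambda>_. {0<..1}" a']) auto
      moreover have "n = n'" using A both unfolding M_def by (intro PiE_ext[of n S "\<lambda>_. UNIV" n']) auto
      ultimately show "a = a' \<and> n = n'" by blast
    qed
    have img: "g ` Sigma L M = ?X"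
    proof
      show "g ` Sigma L M \<subseteq> ?X"
      proof (rule image_subsetI, clarify)
        fix a n assume A: "a \<in> L" "n \<in> M a"
        let ?u = "\<lambda>v. (a v + real (n v)) / real k"
        have "comb ?u \<in> rel_interior (convex hull S)"
          unfolding rel_interior_convex_hull_explicit[OF S(1)] comb_def
        proof (intro CollectI exI[of _ ?u] conjI ballI)
          show "0 < ?u v" if "v \<in> S" for v
            using A that k unfolding L_def by (auto intro!: divide_pos_pos add_pos_nonneg)
          show "sum ?u S = 1" using sums[OF A] k by (simp add: sum_divide_distrib[symmetric])
        qed simp
        moreover have "real k *\<^sub>R comb ?u = g (a, n)"
          unfolding g_def comb_def using k by (simp add: scaleR_right.sum)
        moreover have "g (a, n) = comb a + (\<Sum>v\<in>S. real (n v) *\<^sub>R v)"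
          unfolding g_def comb_def by (simp add: scaleR_left_distrib sum.distrib)
        then have "g (a, n) \<in> integer_points"
          using A(1) natcomb[of n] unfolding L_def by (simp add: integer_points_add)
        ultimately show "g (a, n) \<in> ?X" by (metis (no_types, lifting) IntI image_eqI)
      qed
      show "?X \<subseteq> g ` Sigma L M"
      proof
        fix y assume "y \<in> ?X"
        then obtain x where y: "y = real k *\<^sub>R x" and x: "x \<in> rel_interior (convex hull S)"
          and int: "real k *\<^sub>R x \<in> integer_points" by blast
        obtain u where u: "\<forall>v\<in>S. 0 < u v" "sum u S = 1" "(\<Sum>v\<in>S. u v *\<^sub>R v) = x"
          using x unfolding rel_interior_convex_hull_explicit[OF S(1)] by blast
        define c where "c v = real k * u v" for v
        have c: "\<forall>v\<in>S. 0 < c v" "sum c S = real k" "comb c = real k *\<^sub>R x"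
          unfolding c_def comb_def u(3)[symmetric]
          using u(1,2) k by (simp_all add: sum_distrib_left[symmetric] scaleR_right.sum)
        \<comment> \<open>The remainder has to lie in (0, 1], hence the ceiling minus one and not
          the floor; positivity of \<open>c v\<close> makes this a natural number.\<close>
        define n where "n = (\<lambda>v\<in>S. nat (\<lceil>c v\<rceil> - 1))"
        define a where "a = (\<lambda>v\<in>S. c v - real (n v))"
        have nv: "real (n v) = of_int \<lceil>c v\<rceil> - 1" if "v \<in> S" for v
          using c(1) that unfolding n_def by (auto simp: le_ceiling_iff)
        have av: "0 < a v \<and> a v \<le> 1" if "v \<in> S" for v
          using nv[OF that] that unfolding a_def by (auto) linarith+
        have suma: "sum a S = real k - real (sum n S)"
          unfolding a_def using c(2) by (simp add: sum_subtractf)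
        have "comb a = comb c - (\<Sum>v\<in>S. real (n v) *\<^sub>R v)"
          unfolding a_def comb_def by (simp add: scaleR_left_diff_distrib sum_subtractf)
        then have "comb a \<in> integer_points"
          using c(3) int natcomb[of n] by (simp add: integer_points_diff)
        then have aL: "a \<in> L"
          using av suma unfolding L_def by (auto simp: a_def)
        have "h a + sum n S = k" using h(1)[OF aL] suma by linarith
        then have "n \<in> M a" unfolding M_def n_def by auto
        moreover have "g (a, n) = real k *\<^sub>R x"
          unfolding g_def c(3)[symmetric] a_def comb_def by (auto intro!: sum.cong)
        ultimately show "y \<in> g ` Sigma L M" using aL y by (metis SigmaI image_eqI)
      qed
    qed
    have "finite (Sigma L M)" using finL M by blast
    then have finX: "finite ?X" using img by (metis finite_imageI)
    have "card ?X = card (Sigma L M)" using card_image[OF inj] img by simp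
    then have "card ?X = (\<Sum>a\<in>L. card (M a))" using finL M by (simp add: card_SigmaI)
    \<comment> \<open>Here \<open>k >= 1\<close> absorbs the extreme height
      \<open>m + 1\<close>.\<close>
    moreover have "h a \<le> k + m" if "a \<in> L" for a using h(3)[OF that] k by linarith
    ultimately have "real (card ?X) = (\<Sum>a\<in>L. poly (shifted_binomial_poly m (h a)) (real k))"
      using M by (auto intro!: sum.cong simp: poly_shifted_binomial_poly)
    then have "real (card ?X) = poly p (real k)" unfolding p_def poly_sum .
    then show ?thesis using finX by blast
  qed
  show thesis by (rule that[of p]) (use deg pos card count in auto)
qed

section \<open>Lattice point counts and volume\<close>

text \<open>The half-open cube lies between an open box and its closed box, which differ by a null
  set.\<close>

lemma half_open_cube_measure:
  fixes p :: "real ^ 'd"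
  assumes k: "k > 0"
  shows "{x. \<forall>i. p $ i \<le> k * x $ i \<and> k * x $ i < p $ i + 1} \<in> lmeasurable"
    and "measure lebesgue {x. \<forall>i. p $ i \<le> k * x $ i \<and> k * x $ i < p $ i + 1} = (1 / k) ^ CARD('d)"
proof -
  let ?H = "{x. \<forall>i. p $ i \<le> k * x $ i \<and> k * x $ i < p $ i + 1}"
  define a where "a = (\<chi> i. p $ i / k)"
  define b where "b = (\<chi> i. (p $ i + 1) / k)"
  have box: "box a b \<subseteq> ?H" "?H \<subseteq> cbox a b"
    unfolding a_def b_def using k by (auto simp: subset_iff mem_box_cart field_simps less_imp_le)
  have neg: "negligible ((cbox a b - ?H) \<union> (?H - cbox a b))"
    by (rule negligible_subset[OF negligible_frontier_interval[of a b]]) (use box in auto)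
  have le: "a $ i \<le> b $ i" for i unfolding a_def b_def using k by (simp add: field_simps)
  then have "a \<in> cbox a b" by (simp add: mem_box_cart)
  then have "measure lebesgue (cbox a b) = (\<Prod>i\<in>UNIV. b $ i - a $ i)"
    using content_cbox_cart[of a b] by auto
  also have "\<dots> = (1 / k) ^ CARD('d)" unfolding a_def b_def by (simp add: diff_divide_distrib[symmetric])
  finally show "measure lebesgue ?H = (1 / k) ^ CARD('d)"
    using measure_negligible_symdiff[OF lmeasurable_cbox neg] by simp
  show "?H \<in> lmeasurable" by (rule lmeasurable_negligible_symdiff[OF lmeasurable_cbox neg])
qed

text \<open>
  Rounding \<open>x\<close> down to the grid of mesh \<open>1 / k\<close> turns the lattice points of \<open>k P\<close> into a disjoint
  union of cubes, whose indicator functions converge to that of \<open>P\<close> away from its frontier.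
\<close>

lemma lattice_count_tendsto_measure:
  fixes P :: "(real ^ 'd) set"
  assumes P: "compact P" "negligible (frontier P)"
    and fin: "\<And>k::nat. k > 0 \<Longrightarrow> finite ((\<lambda>x. real k *\<^sub>R x) ` P \<inter> integer_points)"
  shows "(\<lambda>n. real (card ((\<lambda>x. real (Suc n) *\<^sub>R x) ` P \<inter> integer_points)) / real (Suc n) ^ CARD('d))
    \<longlonglongrightarrow> measure lebesgue P"
proof -
  define X where "X n = (\<lambda>x. real (Suc n) *\<^sub>R x) ` P \<inter> integer_points" for n
  define q where "q n x = (\<chi> i. of_int \<lfloor>real (Suc n) * x $ i\<rfloor> / real (Suc n))" for n and x :: "real ^ 'd"
  define E where "E n = {x. q n x \<in> P}" for n
  define H where "H n p = {x. \<forall>i. p $ i \<le> real (Suc n) * x $ i \<and> real (Suc n) * x $ i < p $ i + 1}"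
    for n and p :: "real ^ 'd"
  have finX: "finite (X n)" for n unfolding X_def using fin[of "Suc n"] by simp
  have floorH: "x \<in> H n p \<longleftrightarrow> p = real (Suc n) *\<^sub>R q n x" if p: "p \<in> integer_points" for n x p
  proof -
    have "p $ i \<le> real (Suc n) * x $ i \<and> real (Suc n) * x $ i < p $ i + 1
        \<longleftrightarrow> p $ i = of_int \<lfloor>real (Suc n) * x $ i\<rfloor>" for i
    proof -
      obtain z where z: "p $ i = of_int z" using p unfolding integer_points_def by (auto elim: Ints_cases)
      show ?thesis unfolding z of_int_eq_iff using floor_eq_iff[of "real (Suc n) * x $ i" z] by auto
    qed
    then show ?thesis unfolding H_def q_def by (simp add: vec_eq_iff)
  qed
  have EU: "E n = (\<Union>p\<in>X n. H n p)" for n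
  proof
    show "E n \<subseteq> (\<Union>p\<in>X n. H n p)"
    proof
      fix x assume x: "x \<in> E n"
      let ?p = "real (Suc n) *\<^sub>R q n x"
      have "?p \<in> integer_points" unfolding integer_points_def q_def by simp
      then have "?p \<in> X n" "x \<in> H n ?p" using x floorH unfolding X_def E_def by auto
      then show "x \<in> (\<Union>p\<in>X n. H n p)" by blast
    qed
    show "(\<Union>p\<in>X n. H n p) \<subseteq> E n"
    proof
      fix x assume "x \<in> (\<Union>p\<in>X n. H n p)"
      then obtain y where y: "y \<in> P" "real (Suc n) *\<^sub>R y \<in> integer_points" "x \<in> H n (real (Suc n) *\<^sub>R y)"
        unfolding X_def by blast
      then have "real (Suc n) *\<^sub>R y = real (Suc n) *\<^sub>R q n x" using floorH by blast
      then have "y = q n x" by (simp del: of_nat_Suc)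
      then show "x \<in> E n" using y(1) unfolding E_def by simp
    qed
  qed
  have disj: "disjoint_family_on (H n) (X n)" for n
    unfolding disjoint_family_on_def X_def using floorH by (metis IntE disjoint_iff)
  have Hm: "H n p \<in> lmeasurable" "measure lebesgue (H n p) = (1 / real (Suc n)) ^ CARD('d)" for n p
    unfolding H_def by (rule half_open_cube_measure, simp)+
  have Em: "E n \<in> sets lebesgue" for n
    unfolding EU using finX Hm(1) by (intro sets.finite_UN) (auto simp: fmeasurableD)
  have meas: "measure lebesgue (E n) = real (card (X n)) / real (Suc n) ^ CARD('d)" for n
  proof -
    have "measure lebesgue (E n) = (\<Sum>p\<in>X n. measure lebesgue (H n p))"
      unfolding EU
    proof (rule measure_finite_Union[OF finX _ disj])
      show "H n ` X n \<subseteq> sets lebesgue" using Hm(1) fmeasurableD by blast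
      show "emeasure lebesgue (H n p) \<noteq> \<infinity>" for p
        unfolding infinity_ennreal_def by (rule fmeasurableD2[OF Hm(1)])
    qed
    then show ?thesis unfolding Hm(2) by (simp add: power_divide)
  qed
  have dist: "norm (x - q n x) \<le> real CARD('d) * (1 / real (Suc n))" for n x
  proof -
    have "\<bar>(x - q n x) $ i\<bar> \<le> 1 / real (Suc n)" for i
    proof -
      have "(x - q n x) $ i = (real (Suc n) * x $ i - of_int \<lfloor>real (Suc n) * x $ i\<rfloor>) / real (Suc n)"
        unfolding q_def by (simp add: diff_divide_distrib del: of_nat_Suc)
      moreover have "0 \<le> real (Suc n) * x $ i - of_int \<lfloor>real (Suc n) * x $ i\<rfloor>"
        "real (Suc n) * x $ i - of_int \<lfloor>real (Suc n) * x $ i\<rfloor> \<le> 1" by linarith+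
      ultimately show ?thesis by (simp add: divide_right_mono del: of_nat_Suc)
    qed
    then have "(\<Sum>i\<in>UNIV. \<bar>(x - q n x) $ i\<bar>) \<le> real CARD('d) * (1 / real (Suc n))"
      by (intro sum_bounded_above) auto
    then show ?thesis using norm_le_l1_cart[of "x - q n x"] by linarith
  qed
  have conv: "(\<lambda>n. q n x) \<longlonglongrightarrow> x" for x
  proof -
    have "(\<lambda>n. real CARD('d) * (1 / real (Suc n))) \<longlonglongrightarrow> real CARD('d) * 0"
      by (intro tendsto_mult tendsto_const) (use LIMSEQ_inverse_real_of_nat in \<open>simp add: inverse_eq_divide\<close>)
    moreover have "eventually (\<lambda>n. norm (x - q n x) \<le> real CARD('d) * (1 / real (Suc n))) sequentially"
      using dist by (intro always_eventually allI)
    ultimately have "(\<lambda>n. x - q n x) \<longlonglongrightarrow> 0"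
      by (intro Lim_null_comparison[of "\<lambda>n. x - q n x"]) auto
    then have "(\<lambda>n. x - (x - q n x)) \<longlonglongrightarrow> x - 0" by (intro tendsto_diff tendsto_const)
    then show ?thesis by simp
  qed
  \<comment> \<open>Points of the interior and of the open complement keep their side under
    sufficiently fine rounding; only frontier points can oscillate.\<close>
  have ind: "(\<lambda>n. indicator (E n) x :: real) \<longlonglongrightarrow> indicator P x" if x: "x \<notin> frontier P" for x
  proof -
    have "eventually (\<lambda>n. indicator (E n) x = (indicator P x :: real)) sequentially"
    proof (cases "x \<in> P")
      case True
      then have "x \<in> interior P" using x closure_subset unfolding frontier_def by blast
      then have "eventually (\<lambda>n. q n x \<in> interior P) sequentially"
        using topological_tendstoD[OF conv open_interior] by blast
      then show ?thesis
        by eventually_elim (use True interior_subset in \<open>auto simp: E_def indicator_def\<close>)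
    next
      case False
      have "open (- P)" using P(1) compact_imp_closed by blast
      then have "eventually (\<lambda>n. q n x \<in> - P) sequentially"
        using topological_tendstoD[OF conv, of "- P" x] False by blast
      then show ?thesis by eventually_elim (use False in \<open>auto simp: E_def indicator_def\<close>)
    qed
    then show ?thesis by (rule tendsto_eventually)
  qed
  obtain R where R: "\<And>x. x \<in> P \<Longrightarrow> norm x \<le> R"
    using compact_imp_bounded[OF P(1)] unfolding bounded_iff by blast
  \<comment> \<open>One ball contains all the sets \<open>E n\<close>, since rounding moves a point
    by at most \<open>CARD('d)\<close> whatever the mesh. Its indicator is the dominating
    function.\<close>
  have Ebound: "x \<in> cball 0 (R + real CARD('d))" if "x \<in> E n" for x n
  proof -
    have "norm (x - q n x) \<le> real CARD('d) * 1"
      using dist[of x n] by (rule order_trans) (intro mult_left_mono, auto)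
    moreover have "norm (q n x) \<le> R" using that R unfolding E_def by blast
    ultimately show ?thesis using norm_triangle_ineq[of "x - q n x" "q n x"] by simp
  qed
  have lim: "(\<lambda>n. integral\<^sup>L lebesgue (\<lambda>x. indicator (E n) x :: real))
      \<longlonglongrightarrow> integral\<^sup>L lebesgue (\<lambda>x. indicator P x :: real)"
  proof (rule integral_dominated_convergence[where w = "indicator (cball 0 (R + real CARD('d)))"])
    show "(\<lambda>x. indicator P x :: real) \<in> borel_measurable lebesgue"
      using lmeasurable_compact[OF P(1)] by (intro borel_measurable_indicator) (simp add: fmeasurableD)
    show "(\<lambda>x. indicator (E n) x :: real) \<in> borel_measurable lebesgue" for n
      using Em by (intro borel_measurable_indicator)
    show "integrable lebesgue (indicator (cball (0::real^'d) (R + real CARD('d))) :: _ \<Rightarrow> real)"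
      using lmeasurable_compact[OF compact_cball] by (simp add: lmeasurable_iff_integrable)
    have "AE x in lebesgue. x \<notin> frontier P"
      using P(2) unfolding negligible_iff_null_sets by (rule AE_not_in)
    then show "AE x in lebesgue. (\<lambda>n. indicator (E n) x :: real) \<longlonglongrightarrow> indicator P x"
      by eventually_elim (rule ind)
    show "AE x in lebesgue. norm (indicator (E n) x :: real) \<le> indicator (cball 0 (R + real CARD('d))) x" for n
      using Ebound by (intro AE_I2) (auto simp: indicator_def)
  qed
  then have "(\<lambda>n. measure lebesgue (E n)) \<longlonglongrightarrow> measure lebesgue P" by simp
  then show ?thesis unfolding meas X_def .
qed

text \<open>After division by the power of degree \<open>d\<close> all lower terms tend to 0. The
  degree may be smaller than \<open>d\<close>; the limit is then 0.\<close>

lemma coeff_eq_limit: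
  fixes p :: "real poly"
  assumes deg: "degree p \<le> d" and lim: "(\<lambda>n. poly p (real (Suc n)) / real (Suc n) ^ d) \<longlonglongrightarrow> L"
  shows "coeff p d = L"
proof -
  have "(\<lambda>n. \<Sum>i\<le>d. coeff p i * (1 / real (Suc n)) ^ (d - i)) \<longlonglongrightarrow> (\<Sum>i\<le>d. coeff p i * 0 ^ (d - i))"
    by (intro tendsto_sum tendsto_mult tendsto_power tendsto_const)
      (use LIMSEQ_inverse_real_of_nat in \<open>simp add: inverse_eq_divide\<close>)
  moreover have "(\<Sum>i\<le>d. coeff p i * (1 / real (Suc n)) ^ (d - i)) = poly p (real (Suc n)) / real (Suc n) ^ d" for n
  proof -
    have "poly p (real (Suc n)) = (\<Sum>i\<le>d. coeff p i * real (Suc n) ^ i)"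
      unfolding poly_altdef using deg by (intro sum.mono_neutral_left) (auto simp: coeff_eq_0)
    moreover have "real (Suc n) ^ i / real (Suc n) ^ d = (1 / real (Suc n)) ^ (d - i)" if "i \<le> d" for i
    proof -
      have "real (Suc n) ^ d = real (Suc n) ^ (d - i) * real (Suc n) ^ i"
        using that by (simp add: power_add[symmetric] del: of_nat_Suc)
      then show ?thesis by (simp add: power_one_over del: of_nat_Suc)
    qed
    ultimately show ?thesis
      by (simp add: sum_divide_distrib times_divide_eq_right[symmetric] del: of_nat_Suc times_divide_eq_right)
  qed
  moreover have "(\<Sum>i\<le>d. coeff p i * 0 ^ (d - i)) = coeff p d"
    by (subst sum.remove[of _ d]) (auto simp: power_0_left intro!: sum.neutral)
  ultimately show ?thesis using lim LIMSEQ_unique by simp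
qed

section \<open>The covector decomposition as a polytopal complex\<close>

text \<open>Constraints that are strict at \<open>x\<close> stay strict near \<open>x\<close>, and
  those tight at \<open>x\<close> hold with equality on the affine hull of \<open>C\<close>. A
  neighbourhood of \<open>x\<close> in that hull thus lies in \<open>C\<close>.\<close>

lemma rel_interior_halfspaces_tight:
  fixes x :: "'a::euclidean_space"
  assumes T: "finite T" and C: "C = {y. \<forall>(a, b)\<in>T. a \<bullet> y \<le> b}" and x: "x \<in> C"
    and tight: "\<And>a b y. (a, b) \<in> T \<Longrightarrow> a \<bullet> x = b \<Longrightarrow> y \<in> C \<Longrightarrow> a \<bullet> y = b"
  shows "x \<in> rel_interior C"
proof -
  define T' where "T' = {(a, b) \<in> T. a \<bullet> x < b}"
  define U where "U = (\<Inter>(a, b)\<in>T'. {y. a \<bullet> y < b})"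
  have "finite T'" using T unfolding T'_def by (rule rev_finite_subset) auto
  then have "open U" unfolding U_def by (intro open_INT) (auto simp: open_halfspace_lt)
  moreover have "x \<in> U" unfolding U_def T'_def by auto
  moreover have "U \<inter> affine hull C \<subseteq> C"
  proof
    fix y assume y: "y \<in> U \<inter> affine hull C"
    have "a \<bullet> y \<le> b" if ab: "(a, b) \<in> T" for a b
    proof (cases "a \<bullet> x = b")
      case True
      have "affine hull C \<subseteq> {y. a \<bullet> y = b}"
        using tight[OF ab True] by (intro hull_minimal affine_hyperplane) auto
      then show ?thesis using y by auto
    next
      case False
      then have "(a, b) \<in> T'" using x ab unfolding T'_def C by fastforce
      then have "a \<bullet> y < b" using y unfolding U_def by blast
      then show ?thesis by simp
    qed
    then show "y \<in> C" unfolding C by auto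
  qed
  ultimately show ?thesis using x unfolding mem_rel_interior by blast
qed

section \<open>Cells as finite intersections of half-spaces\<close>

definition hvec :: "'d option \<Rightarrow> real ^ 'd" where
  "hvec i = (case i of None \<Rightarrow> 0 | Some j \<Rightarrow> axis j 1)"

definition hconst :: "'d option \<Rightarrow> real" where
  "hconst i = (case i of None \<Rightarrow> 1 | Some j \<Rightarrow> 0)"

lemma hcoord_affine: "hcoord x i = hvec i \<bullet> x + hconst i"
  unfolding hcoord_def hvec_def hconst_def by (cases i) (auto simp: inner_axis inner_commute)

lemma hcoord_None [simp]: "hcoord x None = 1"
  and hcoord_Some [simp]: "hcoord x (Some j) = x $ j"
  unfolding hcoord_def by simp_all

lemma hcoord_nonneg: "(\<And>i. 0 \<le> x $ i) \<Longrightarrow> 0 \<le> hcoord x i"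
  by (cases i) auto

text \<open>A pair \<open>(a, b)\<close> stands for the half-space
  \<open>a \<bullet> y \<le> b\<close>. The constraints themselves are recorded, not only their
  intersection, so that those tight at a point can be singled out.\<close>

definition cell_constraints :: "('d option \<times> (real ^ 'd)) set \<Rightarrow> ((real ^ 'd) \<times> real) set" where
  "cell_constraints G = range (\<lambda>j. (- hvec (Some j), 0)) \<union>
     (\<lambda>((i, w), k). (hcoord w k *\<^sub>R hvec i - hcoord w i *\<^sub>R hvec k,
        hcoord w i * hconst k - hcoord w k * hconst i)) ` (G \<times> UNIV)"

lemma covector_set_halfspaces: "covector_set G = {y. \<forall>(a, b)\<in>cell_constraints G. a \<bullet> y \<le> b}"
proof -
  have 1: "0 \<le> y $ j \<longleftrightarrow> (- hvec (Some j)) \<bullet> y \<le> 0" for y :: "real ^ 'd" and j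
    unfolding hvec_def by (simp add: inner_axis inner_commute)
  have 2: "hcoord w k * hcoord y i \<le> hcoord w i * hcoord y k \<longleftrightarrow>
      (hcoord w k *\<^sub>R hvec i - hcoord w i *\<^sub>R hvec k) \<bullet> y \<le> hcoord w i * hconst k - hcoord w k * hconst i"
    for y w :: "real ^ 'd" and i k
    unfolding hcoord_affine[of y] by (simp add: inner_diff_left algebra_simps)
  show ?thesis
    unfolding covector_set_def cell_constraints_def 1 2 by (auto simp: ball_Un)
qed

lemma convex_covector_set: "convex (covector_set G)"
proof -
  have "covector_set G = (\<Inter>(a, b)\<in>cell_constraints G. {y. a \<bullet> y \<le> b})"
    unfolding covector_set_halfspaces by auto
  then show ?thesis by (auto intro!: convex_INT convex_halfspace_le)
qed

lemma covector_set_Un: "covector_set (G \<union> H) = covector_set G \<inter> covector_set H"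
  unfolding covector_set_def ball_Un by auto

section \<open>Points, covectors and cells relative to a generating set\<close>

locale max_generated =
  fixes W P :: "(real ^ 'd) set"
  assumes generates: "generates W P"
begin

lemma finite_W: "finite W" and W_nonempty: "W \<noteq> {}"
  and P_eq: "P = {x. \<exists>l. max_combination W l x}"
  using generates unfolding generates_def by auto

lemma hcoord_W: "w \<in> W \<Longrightarrow> 0 \<le> hcoord w i"
  using generates unfolding generates_def by (intro hcoord_nonneg) auto

text \<open>The normalisation of the largest coefficient to 1 is just the equation for the
  coordinate \<open>None\<close>, where points and generators all have the value 1.\<close>

lemma mem_P_iff:
  "x \<in> P \<longleftrightarrow> (\<exists>l. (\<forall>w\<in>W. 0 \<le> l w) \<and>
    (\<forall>i. (\<forall>w\<in>W. l w * hcoord w i \<le> hcoord x i) \<and> (\<exists>w\<in>W. l w * hcoord w i = hcoord x i)))"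
proof -
  have "(\<forall>i. Q i) \<longleftrightarrow> Q None \<and> (\<forall>j. Q (Some j))" for Q :: "'d option \<Rightarrow> bool"
    by (metis option.exhaust)
  then show ?thesis
    unfolding P_eq max_combination_iff[OF finite_W W_nonempty] by auto
qed

lemma P_nonempty: "P \<noteq> {}"
  using generator_mem[OF generates] W_nonempty by blast

lemma P_nonneg: "x \<in> P \<Longrightarrow> 0 \<le> hcoord x i"
  unfolding mem_P_iff using hcoord_W by (metis mult_nonneg_nonneg)

lemma bounded_P: "bounded P"
proof (rule bounded_subset[OF bounded_cbox])
  show "P \<subseteq> cbox 0 (\<Sum>w\<in>W. w)"
  proof
    fix x assume x: "x \<in> P"
    then obtain l where l: "\<forall>w\<in>W. 0 \<le> l w \<and> l w \<le> 1" "\<forall>i. \<exists>w\<in>W. l w * w $ i = x $ i"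
      unfolding P_eq max_combination_iff[OF finite_W W_nonempty] by blast
    have "x $ i \<le> (\<Sum>w\<in>W. w) $ i" for i
    proof -
      obtain w where w: "w \<in> W" "l w * w $ i = x $ i" using l by blast
      have nn: "0 \<le> v $ i" if "v \<in> W" for v using hcoord_W[OF that, of "Some i"] by simp
      have "x $ i \<le> w $ i" using w l nn[OF w(1)] by (metis mult_left_le_one_le)
      also have "\<dots> \<le> (\<Sum>v\<in>W. v $ i)" using finite_W w(1) nn by (intro member_le_sum) auto
      finally show ?thesis by (simp add: sum_component)
    qed
    moreover have "0 \<le> x $ i" for i using P_nonneg[OF x, of "Some i"] by simp
    ultimately show "x \<in> cbox 0 (\<Sum>w\<in>W. w)" by (simp add: mem_box_cart)
  qed
qed

definition admissible :: "('d option \<times> (real ^ 'd)) set \<Rightarrow> bool" where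
  "admissible G \<longleftrightarrow> G \<subseteq> UNIV \<times> W \<and> (\<forall>i. \<exists>w. (i, w) \<in> G) \<and>
    (\<forall>w\<in>W. \<exists>i. (i, w) \<in> G \<and> 0 < hcoord w i)"

text \<open>For nonnegative \<open>x\<close> this is the largest \<open>G\<close> with
  \<open>x\<close> in \<open>covector_set G\<close>. A pair with \<open>w_i > 0\<close> says that
  \<open>x_i / w_i\<close> is the least of the ratios \<open>x_k / w_k\<close> with
  \<open>w_k > 0\<close>; one with \<open>w_i = 0\<close> says \<open>x_i = 0\<close>.\<close>

definition covector :: "real ^ 'd \<Rightarrow> ('d option \<times> (real ^ 'd)) set" where
  "covector x = {(i, w). w \<in> W \<and> (\<forall>k. hcoord w k * hcoord x i \<le> hcoord w i * hcoord x k)}"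

lemma finite_subset_generators: "G \<subseteq> (UNIV :: 'd option set) \<times> W \<Longrightarrow> finite G"
  by (erule finite_subset) (simp add: finite_W)

lemma admissible_finite: "admissible G \<Longrightarrow> finite G"
  unfolding admissible_def using finite_subset_generators by blast

lemma admissible_mono: "admissible G \<Longrightarrow> G \<subseteq> H \<Longrightarrow> H \<subseteq> UNIV \<times> W \<Longrightarrow> admissible H"
  unfolding admissible_def by blast

lemma mem_covector_set_iff:
  "G \<subseteq> UNIV \<times> W \<Longrightarrow> x \<in> covector_set G \<longleftrightarrow> (\<forall>i. 0 \<le> x $ i) \<and> G \<subseteq> covector x"
  unfolding covector_set_def covector_def by auto

lemma covector_subset: "covector x \<subseteq> UNIV \<times> W"
  unfolding covector_def by auto

lemma mem_covector_set_covector: "x \<in> P \<Longrightarrow> x \<in> covector_set (covector x)"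
  using P_nonneg[of x "Some _"] by (simp add: mem_covector_set_iff[OF covector_subset])

text \<open>A generator attaining the maximum in coordinate \<open>i\<close> supplies a pair for
  \<open>i\<close>; a coordinate with least ratio \<open>x_i / w_i\<close> on the support of
  \<open>w\<close> supplies one for \<open>w\<close>. The support always contains
  \<open>None\<close>.\<close>

lemma admissible_covector:
  assumes x: "x \<in> P"
  shows "admissible (covector x)"
  unfolding admissible_def
proof (intro conjI allI ballI covector_subset)
  obtain l where l: "\<And>i w. w \<in> W \<Longrightarrow> l w * hcoord w i \<le> hcoord x i"
    "\<And>i. \<exists>w\<in>W. l w * hcoord w i = hcoord x i"
    using x unfolding mem_P_iff by blast
  show "\<exists>w. (i, w) \<in> covector x" for i
  proof -
    obtain w where w: "w \<in> W" "l w * hcoord w i = hcoord x i" using l(2) by blast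
    have "hcoord w k * hcoord x i \<le> hcoord w i * hcoord x k" for k
    proof -
      have "hcoord w k * hcoord x i = hcoord w i * (l w * hcoord w k)" using w(2) by (simp add: ac_simps flip: w(2))
      also have "\<dots> \<le> hcoord w i * hcoord x k" using l(1)[OF w(1)] hcoord_W[OF w(1)] by (intro mult_left_mono)
      finally show ?thesis .
    qed
    then show ?thesis using w unfolding covector_def by blast
  qed
  fix w assume w: "w \<in> W"
  let ?I = "{i. 0 < hcoord w i}"
  have "None \<in> ?I" by simp
  then have "\<exists>i. is_arg_min (\<lambda>k. hcoord x k / hcoord w k) (\<lambda>k. k \<in> ?I) i"
    by (intro ex_is_arg_min_if_finite finite) blast
  then obtain i where i: "i \<in> ?I" "\<And>k. k \<in> ?I \<Longrightarrow> hcoord x i / hcoord w i \<le> hcoord x k / hcoord w k"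
    unfolding is_arg_min_linorder by blast
  have "hcoord w k * hcoord x i \<le> hcoord w i * hcoord x k" for k
  proof (cases "k \<in> ?I")
    case True
    then show ?thesis using i(1) i(2)[OF True] by (simp add: field_simps)
  next
    case False
    then have "hcoord w k = 0" using hcoord_W[OF w, of k] by simp
    then show ?thesis using i(1) P_nonneg[OF x, of k] by simp
  qed
  then show "\<exists>i. (i, w) \<in> covector x \<and> 0 < hcoord w i" using i(1) w unfolding covector_def by blast
qed

text \<open>The coefficient of \<open>w\<close> is the ratio \<open>x_i / w_i\<close> at a pair
  \<open>(i, w)\<close> with \<open>w_i > 0\<close>, the largest one keeping the multiple of
  \<open>w\<close> below \<open>x\<close>. Pairs \<open>(k, w)\<close> show that the maximum in each
  coordinate \<open>k\<close> is attained.\<close>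

lemma covector_set_subset_P:
  assumes G: "admissible G"
  shows "covector_set G \<subseteq> P"
proof
  fix x assume "x \<in> covector_set G"
  then have nn: "0 \<le> hcoord x i"
    and le: "\<And>w k. (i, w) \<in> G \<Longrightarrow> hcoord w k * hcoord x i \<le> hcoord w i * hcoord x k" for i
    unfolding covector_set_def by (auto intro: hcoord_nonneg)
  have "\<forall>w\<in>W. \<exists>i. (i, w) \<in> G \<and> 0 < hcoord w i" using G unfolding admissible_def by blast
  then obtain f where f: "\<And>w. w \<in> W \<Longrightarrow> (f w, w) \<in> G \<and> 0 < hcoord w (f w)" by metis
  define l where "l w = hcoord x (f w) / hcoord w (f w)" for w
  have l_le: "l w * hcoord w k \<le> hcoord x k" if "w \<in> W" for w k
    using le[of "f w" w k] f[OF that] unfolding l_def by (simp add: field_simps)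
  have "\<exists>w\<in>W. l w * hcoord w k = hcoord x k" for k
  proof -
    obtain w where w: "(k, w) \<in> G" "w \<in> W" using G unfolding admissible_def by blast
    have "hcoord x k \<le> l w * hcoord w k"
      using le[OF w(1), of "f w"] f[OF w(2)] unfolding l_def by (simp add: field_simps)
    then show ?thesis using l_le[OF w(2), of k] w(2) by force
  qed
  moreover have "0 \<le> l w" if "w \<in> W" for w
    using nn f[OF that] unfolding l_def by simp
  ultimately show "x \<in> P" unfolding mem_P_iff using l_le by blast
qed

lemma polytope_covector_set:
  assumes G: "admissible G"
  shows "polytope (covector_set G)"
proof -
  have "finite (cell_constraints G)"
    using admissible_finite[OF G] unfolding cell_constraints_def by simp
  moreover have "covector_set G = \<Inter>((\<lambda>(a, b). {y. a \<bullet> y \<le> b}) ` cell_constraints G)"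
    unfolding covector_set_halfspaces by auto
  ultimately have "polyhedron (covector_set G)"
    by (auto intro!: polyhedron_Inter polyhedron_halfspace_le)
  moreover have "bounded (covector_set G)"
    using bounded_subset[OF bounded_P covector_set_subset_P[OF G]] .
  ultimately show ?thesis unfolding polytope_eq_bounded_polyhedron by blast
qed

text \<open>
  With \<open>(j, w) \<in> G\<close> and \<open>w\<^sub>j > 0\<close>, the additional condition \<open>(i, w)\<close> amounts on the cell
  to equality in \<open>w\<^sub>i x\<^sub>j \<le> w\<^sub>j x\<^sub>i\<close>.
\<close>

lemma covector_set_insert_face:
  assumes G: "admissible G" and w: "w \<in> W"
  shows "covector_set (insert (i, w) G) face_of covector_set G"
proof -
  obtain j where j: "(j, w) \<in> G" "0 < hcoord w j" using G w unfolding admissible_def by blast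
  define a where "a = hcoord w j *\<^sub>R hvec i - hcoord w i *\<^sub>R hvec j"
  define b where "b = hcoord w i * hconst j - hcoord w j * hconst i"
  have ab: "a \<bullet> y - b = hcoord w j * hcoord y i - hcoord w i * hcoord y j" for y
    unfolding a_def b_def hcoord_affine[of y] by (simp add: inner_diff_left algebra_simps)
  have le: "hcoord w k * hcoord y j \<le> hcoord w j * hcoord y k" if "y \<in> covector_set G" for y k
    using that j unfolding covector_set_def by blast
  have "(covector_set G \<inter> {y. a \<bullet> y = b}) face_of covector_set G"
  proof (rule face_of_Int_supporting_hyperplane_ge[OF convex_covector_set])
    show "b \<le> a \<bullet> y" if "y \<in> covector_set G" for y
      using ab[of y] le[OF that, of i] by linarith
  qed
  moreover have "covector_set (insert (i, w) G) = covector_set G \<inter> {y. a \<bullet> y = b}"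
  proof (intro set_eqI iffI)
    fix y assume y: "y \<in> covector_set (insert (i, w) G)"
    then have yG: "y \<in> covector_set G" and "hcoord w j * hcoord y i \<le> hcoord w i * hcoord y j"
      unfolding covector_set_def by auto
    then show "y \<in> covector_set G \<inter> {y. a \<bullet> y = b}" using ab[of y] le[OF yG, of i] by simp
  next
    fix y assume y: "y \<in> covector_set G \<inter> {y. a \<bullet> y = b}"
    then have eq: "hcoord w j * hcoord y i = hcoord w i * hcoord y j" using ab[of y] by simp
    \<comment> \<open>Multiplication by \<open>w_j > 0\<close> reduces the inequalities of the new
      pair to those of \<open>(j, w)\<close>.\<close>
    have "hcoord w k * hcoord y i \<le> hcoord w i * hcoord y k" for k
    proof -
      have "hcoord w j * (hcoord w k * hcoord y i) = hcoord w i * (hcoord w k * hcoord y j)"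
        using arg_cong[OF eq, of "(*) (hcoord w k)"] by (simp add: ac_simps)
      also have "\<dots> \<le> hcoord w i * (hcoord w j * hcoord y k)"
        using le[of y k] y hcoord_W[OF w] by (intro mult_left_mono) auto
      finally show ?thesis using j(2) by (simp add: mult.left_commute)
    qed
    then show "y \<in> covector_set (insert (i, w) G)" using y unfolding covector_set_def by auto
  qed
  ultimately show ?thesis by simp
qed

text \<open>Pairs are added one at a time, each step passing to a face. As unions of index sets give
  intersections of covector sets, two cells meet in a face of each.\<close>

lemma covector_set_Un_face:
  assumes G: "admissible G" and H: "H \<subseteq> UNIV \<times> W"
  shows "covector_set (G \<union> H) face_of covector_set G"
proof -
  have "finite H" using H by (rule finite_subset_generators)
  then show ?thesis using H
  proof (induction H rule: finite_induct)
    case empty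
    then show ?case by (simp add: convex_covector_set face_of_refl)
  next
    case (insert p H)
    obtain i w where p: "p = (i, w)" "w \<in> W" using insert.prems by auto
    have "admissible (G \<union> H)"
      using G insert.prems by (intro admissible_mono[OF G]) (auto simp: admissible_def)
    then have "covector_set (insert (i, w) (G \<union> H)) face_of covector_set (G \<union> H)"
      using p by (intro covector_set_insert_face)
    then show ?case using insert face_of_trans p by (metis Un_insert_right insert_subset)
  qed
qed

text \<open>By maximality of the covector, a constraint tight at \<open>x\<close> brings a further
  pair into it, and this pair forces equality on the whole cell.\<close>

lemma mem_rel_interior_covector_set:
  assumes x: "x \<in> P"
  shows "x \<in> rel_interior (covector_set (covector x))"
proof (rule rel_interior_halfspaces_tight[OF _ covector_set_halfspaces])
  let ?G = "covector x"
  note G = admissible_covector[OF x]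
  show "finite (cell_constraints ?G)"
    using admissible_finite[OF G] unfolding cell_constraints_def by simp
  show "x \<in> covector_set ?G" by (rule mem_covector_set_covector[OF x])
  fix a b y assume ab: "(a, b) \<in> cell_constraints ?G" "a \<bullet> x = b" and y: "y \<in> covector_set ?G"
  have le: "hcoord w k * hcoord y i \<le> hcoord w i * hcoord y k" if "(i, w) \<in> ?G" for i w k
    using y that unfolding covector_set_def by blast
  have ynn: "0 \<le> hcoord y i" for i using y unfolding covector_set_def by (auto intro: hcoord_nonneg)
  consider j where "a = - hvec (Some j)" "b = 0"
    | i w k where "(i, w) \<in> ?G" "a = hcoord w k *\<^sub>R hvec i - hcoord w i *\<^sub>R hvec k"
        "b = hcoord w i * hconst k - hcoord w k * hconst i"
    using ab(1) unfolding cell_constraints_def by auto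
  then show "a \<bullet> y = b"
  proof cases
    case 1
    have av: "a \<bullet> z = - hcoord z (Some j)" for z
      unfolding hcoord_affine using 1 by (simp add: hconst_def)
    then have xj: "hcoord x (Some j) = 0" using ab(2) 1 by simp
    \<comment> \<open>A vanishing coordinate of \<open>x\<close> is seen by pairs:
      \<open>(None, w)\<close> gives \<open>w_j <= x_j = 0\<close>, so \<open>(Some j, w)\<close>
      belongs to the covector and forces \<open>y_j = 0\<close>.\<close>
    obtain w where w: "(None, w) \<in> ?G" "w \<in> W" using G unfolding admissible_def by blast
    have "hcoord w (Some j) \<le> 0"
      using w(1) xj unfolding covector_def by (auto dest!: spec[of _ "Some j"])
    then have wj: "hcoord w (Some j) = 0" using hcoord_W[OF w(2), of "Some j"] by simp
    then have "(Some j, w) \<in> ?G" using w(2) xj unfolding covector_def by simp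
    from le[OF this, of None] have "hcoord y (Some j) = 0" using wj ynn[of "Some j"] by simp
    then show ?thesis using av 1 by simp
  next
    case 2
    have av: "a \<bullet> z - b = hcoord w k * hcoord z i - hcoord w i * hcoord z k" for z
      unfolding hcoord_affine[of z] 2 by (simp add: inner_diff_left algebra_simps)
    have w: "w \<in> W" using 2(1) unfolding covector_def by blast
    have "hcoord w k * hcoord y i = hcoord w i * hcoord y k"
    proof (cases "hcoord w i = 0")
      case True
      then have "hcoord y i = 0" using le[OF 2(1), of None] ynn[of i] by simp
      then show ?thesis using True by simp
    next
      case False
      then have wi: "0 < hcoord w i" using hcoord_W[OF w, of i] by simp
      have eq: "hcoord w i * hcoord x k = hcoord w k * hcoord x i" using av[of x] ab(2) by simp
      \<comment> \<open>Equality at \<open>k\<close> means that \<open>k\<close> satisfies the same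
        minimality as \<open>i\<close>, so \<open>(k, w)\<close> is in the covector and supplies the
        reverse inequality for \<open>y\<close>.\<close>
      have "hcoord w m * hcoord x k \<le> hcoord w k * hcoord x m" for m
      proof -
        have "hcoord w i * (hcoord w m * hcoord x k) = hcoord w m * (hcoord w i * hcoord x k)" by simp
        also have "\<dots> = hcoord w k * (hcoord w m * hcoord x i)" unfolding eq by simp
        also have "\<dots> \<le> hcoord w k * (hcoord w i * hcoord x m)"
          using 2(1) hcoord_W[OF w, of k] unfolding covector_def by (intro mult_left_mono) auto
        finally show ?thesis using wi by (simp add: mult.left_commute)
      qed
      then have "(k, w) \<in> ?G" using w unfolding covector_def by blast
      from le[OF this, of i] le[OF 2(1), of k] show ?thesis by simp
    qed
    then show ?thesis using av[of y] by simp
  qed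
qed

end

lemma generates_generators:
  assumes "max_polytope P"
  shows "generates (generators P) P"
  using theI'[OF ex1_minimal_generating_set[OF assms]]
  unfolding generators_def minimal_generating_set_def by blast

section \<open>The polyhedral complex of cells and its pseudovertices\<close>

context
  fixes P :: "(real ^ 'd) set"
  assumes P: "max_polytope P"
begin

interpretation max_generated "generators P" P
  by unfold_locales (rule generates_generators[OF P])

lemma cells_eq: "cells P = {covector_set G | G. admissible G \<and> covector_set G \<noteq> {}}"
  unfolding cells_def admissible_def by blast

lemma finite_cells: "finite (cells P)"
proof -
  have "cells P \<subseteq> covector_set ` Pow (UNIV \<times> generators P)" unfolding cells_def by blast
  then show ?thesis by (rule finite_subset) (simp add: finite_W)
qed

lemma polytope_cell: "C \<in> cells P \<Longrightarrow> polytope C"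
  unfolding cells_eq using polytope_covector_set by blast

lemma cell_nonempty: "C \<in> cells P \<Longrightarrow> C \<noteq> {}"
  unfolding cells_eq by blast

lemma cell_subset: "C \<in> cells P \<Longrightarrow> C \<subseteq> P"
  unfolding cells_eq using covector_set_subset_P by blast

lemma covector_cell:
  assumes "x \<in> P"
  shows "covector_set (covector x) \<in> cells P" "x \<in> rel_interior (covector_set (covector x))"
  using admissible_covector[OF assms] mem_covector_set_covector[OF assms]
    mem_rel_interior_covector_set[OF assms] unfolding cells_eq by blast+

lemma Union_rel_interior_cells: "(\<Union>C\<in>cells P. rel_interior C) = P"
  using covector_cell cell_subset rel_interior_subset by blast

lemma Union_cells: "\<Union>(cells P) = P"
  using covector_cell cell_subset rel_interior_subset by blast

lemma cells_nonempty: "cells P \<noteq> {}"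
  using P_nonempty covector_cell by blast

lemma cell_Int_face:
  assumes "C \<in> cells P" "D \<in> cells P"
  shows "(C \<inter> D) face_of C"
proof -
  obtain G H where "C = covector_set G" "admissible G" "D = covector_set H" "admissible H"
    using assms unfolding cells_eq by blast
  then show ?thesis using covector_set_Un_face[of G H] covector_set_Un unfolding admissible_def by metis
qed

text \<open>The intersection is a face of \<open>C\<close> that meets the relative interior of
  \<open>C\<close>, so it is \<open>C\<close>.\<close>

lemma cell_subset_if_rel_interior_meets:
  assumes "C \<in> cells P" "D \<in> cells P" "x \<in> D" "x \<in> rel_interior C"
  shows "C \<subseteq> D"
proof -
  have "x \<in> C \<inter> D" using assms rel_interior_subset by blast
  then show ?thesis
    using face_of_disjoint_rel_interior[OF cell_Int_face[OF assms(1,2)]] assms(4) by blast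
qed

lemma disjoint_rel_interior_cells: "disjoint_family_on rel_interior (cells P)"
  unfolding disjoint_family_on_def
proof (intro ballI impI)
  fix C D assume CD: "C \<in> cells P" "D \<in> cells P" "C \<noteq> D"
  show "rel_interior C \<inter> rel_interior D = {}"
  proof (rule ccontr)
    assume "\<not> ?thesis"
    then obtain x where x: "x \<in> rel_interior C" "x \<in> rel_interior D" by blast
    then have "x \<in> C" "x \<in> D" using rel_interior_subset by blast+
    then show False
      using cell_subset_if_rel_interior_meets[OF CD(1,2)] cell_subset_if_rel_interior_meets[OF CD(2,1)] x CD(3)
      by blast
  qed
qed

text \<open>The cell of the covector of \<open>v\<close> has \<open>v\<close> in its relative
  interior and lies in \<open>C\<close>, so it is contained in the face \<open>{v}\<close>. Hence
  \<open>{v}\<close> is itself a cell, which is how integrality of pseudovertices reaches the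
  vertices of all cells.\<close>

lemma extreme_point_pseudovertex:
  assumes C: "C \<in> cells P" and v: "v extreme_point_of C"
  shows "v \<in> pseudovertices P"
proof -
  have vC: "v \<in> C" using v unfolding extreme_point_of_def by blast
  then have vP: "v \<in> P" using cell_subset[OF C] by blast
  let ?D = "covector_set (covector v)"
  note D = covector_cell[OF vP]
  have sub: "?D \<subseteq> C" by (rule cell_subset_if_rel_interior_meets[OF D(1) C vC D(2)])
  have "{v} face_of C" using v by (simp add: face_of_singleton)
  then have "?D \<subseteq> {v}" using subset_of_face_of[OF _ sub] D(2) by blast
  then have "?D = {v}" using D(2) rel_interior_subset by blast
  then have "{v} \<in> cells P" using D(1) by simp
  then show ?thesis unfolding pseudovertices_def by (auto intro!: bexI[of _ "{v}"])
qed

end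

section \<open>The Ehrhart polynomial\<close>

text \<open>The bound on \<open>card S\<close> holds because \<open>S\<close> lies in a cell.
  Equality occurs in a cell of largest dimension, whose relative interior is not covered by open
  simplices of smaller dimension.\<close>

lemma max_polytope_open_simplices:
  fixes P :: "(real ^ 'd) set"
  assumes P: "max_polytope P"
  obtains T where "finite T"
    "\<And>S. S \<in> T \<Longrightarrow> S \<subseteq> pseudovertices P \<and> S \<noteq> {} \<and> \<not> affine_dependent S"
    "disjoint_family_on (\<lambda>S. rel_interior (convex hull S)) T"
    "(\<Union>S\<in>T. rel_interior (convex hull S)) = P"
    "\<And>S. S \<in> T \<Longrightarrow> int (card S) \<le> polytope_dim P + 1"
    "\<exists>S\<in>T. int (card S) = polytope_dim P + 1"
proof -
  let ?o = "\<lambda>S. rel_interior (convex hull S)"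
  have "\<exists>T. finite T \<and> (\<forall>S\<in>T. S \<subseteq> {v. v extreme_point_of C} \<and> S \<noteq> {} \<and> \<not> affine_dependent S) \<and>
      disjoint_family_on ?o T \<and> (\<Union>S\<in>T. ?o S) = rel_interior C" if "C \<in> cells P" for C
    by (rule rel_interior_polytope_open_simplices[OF polytope_cell[OF P that]]) blast
  then obtain f where f: "\<And>C. C \<in> cells P \<Longrightarrow> finite (f C) \<and>
      (\<forall>S\<in>f C. S \<subseteq> {v. v extreme_point_of C} \<and> S \<noteq> {} \<and> \<not> affine_dependent S) \<and>
      disjoint_family_on ?o (f C) \<and> (\<Union>S\<in>f C. ?o S) = rel_interior C" by metis
  let ?T = "\<Union>C\<in>cells P. f C"
  have dim_le: "int (card S) \<le> aff_dim C + 1" if "C \<in> cells P" "S \<in> f C" for C S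
  proof -
    have S: "S \<subseteq> C" "\<not> affine_dependent S"
      using f[OF that(1)] that(2) unfolding extreme_point_of_def by blast+
    then show ?thesis using aff_dim_subset[OF S(1)] aff_dim_affine_independent[OF S(2)] by simp
  qed
  have cell_dim: "aff_dim C \<le> polytope_dim P" if "C \<in> cells P" for C
    unfolding polytope_dim_def using that finite_cells[OF P] by (intro Max_ge) auto
  have le: "int (card S) \<le> polytope_dim P + 1" if "S \<in> ?T" for S
    using that dim_le cell_dim by fastforce
  have "polytope_dim P \<in> aff_dim ` cells P"
    unfolding polytope_dim_def using finite_cells[OF P] cells_nonempty[OF P] by (intro Max_in) auto
  then obtain C where C: "C \<in> cells P" "polytope_dim P = aff_dim C" by blast
  have "\<exists>S\<in>f C. aff_dim C \<le> aff_dim (?o S)"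
    using f[OF C(1)] polytope_imp_convex[OF polytope_cell[OF P C(1)]] cell_nonempty[OF P C(1)]
    by (intro convex_subset_Union_aff_dim) auto
  then obtain S where S: "S \<in> f C" "aff_dim C \<le> aff_dim (?o S)" by blast
  have "\<not> affine_dependent S" using f[OF C(1)] S(1) by blast
  moreover have "aff_dim (?o S) = aff_dim S"
    by (simp add: rel_interior_aff_dim convex_convex_hull aff_dim_convex_hull)
  ultimately have "polytope_dim P + 1 \<le> int (card S)"
    using S(2) C(2) aff_dim_affine_independent[of S] by simp
  then have ex: "\<exists>S\<in>?T. int (card S) = polytope_dim P + 1"
    using le[of S] S(1) C(1) by (intro bexI[of _ S]) auto
  have sub: "S \<subseteq> pseudovertices P \<and> S \<noteq> {} \<and> \<not> affine_dependent S" if "S \<in> ?T" for S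
    using that f extreme_point_pseudovertex[OF P] by blast
  have disj: "disjoint_family_on ?o ?T"
    unfolding disjoint_family_on_def
  proof (intro ballI impI)
    fix S S' assume S: "S \<in> ?T" "S' \<in> ?T" "S \<noteq> S'"
    obtain C C' where C: "C \<in> cells P" "S \<in> f C" "C' \<in> cells P" "S' \<in> f C'" using S by blast
    show "?o S \<inter> ?o S' = {}"
    proof (cases "C = C'")
      case True
      then show ?thesis using f[OF C(1)] C S(3) unfolding disjoint_family_on_def by blast
    next
      case False
      have "?o S \<subseteq> rel_interior C" "?o S' \<subseteq> rel_interior C'" using f[OF C(1)] f[OF C(3)] C by blast+
      then show ?thesis
        using disjoint_rel_interior_cells[OF P] C False unfolding disjoint_family_on_def by blast
    qed
  qed
  have "(\<Union>S\<in>?T. ?o S) = (\<Union>C\<in>cells P. \<Union>S\<in>f C. ?o S)" by blast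
  also have "\<dots> = (\<Union>C\<in>cells P. rel_interior C)" using f by (intro SUP_cong) auto
  also have "\<dots> = P" by (rule Union_rel_interior_cells[OF P])
  finally have "(\<Union>S\<in>?T. ?o S) = P" .
  moreover have "finite ?T" using finite_cells[OF P] f by blast
  ultimately show thesis using that[of ?T] sub disj le ex by blast
qed

theorem theorem3p2:
  fixes P :: "(real ^ 'd) set"
  assumes "lattice_polytope P"
  shows "polytope_dim P \<le> int CARD('d) \<and>
    (\<exists>p :: real poly.
       int (degree p) = polytope_dim P \<and>
       (\<forall>k::nat. k > 0 \<longrightarrow>
          finite ((\<lambda>x. real k *\<^sub>R x) ` P \<inter> integer_points) \<and>
          real (card ((\<lambda>x. real k *\<^sub>R x) ` P \<inter> integer_points)) = poly p (real k)) \<and>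
       P \<in> lmeasurable \<and>
       coeff p CARD('d) = measure lebesgue P)"
proof -
  have P: "max_polytope P" and lattice: "pseudovertices P \<subseteq> integer_points"
    using assms unfolding lattice_polytope_def by auto
  let ?o = "\<lambda>S. rel_interior (convex hull S)"
  let ?dil = "\<lambda>(k::nat) X. (\<lambda>x. real k *\<^sub>R x) ` X \<inter> (integer_points :: (real ^ 'd) set)"
  obtain T where T: "finite T"
      "\<And>S. S \<in> T \<Longrightarrow> S \<subseteq> pseudovertices P \<and> S \<noteq> {} \<and> \<not> affine_dependent S"
      "disjoint_family_on ?o T" "(\<Union>S\<in>T. ?o S) = P"
    and card_le: "\<And>S. S \<in> T \<Longrightarrow> int (card S) \<le> polytope_dim P + 1"
    and card_eq: "\<exists>S\<in>T. int (card S) = polytope_dim P + 1"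
    using max_polytope_open_simplices[OF P] by metis
  have "\<exists>p. degree p + 1 = card S \<and> coeff p (degree p) > 0 \<and>
      (\<forall>k::nat. k > 0 \<longrightarrow> finite (?dil k (?o S)) \<and> real (card (?dil k (?o S))) = poly p (real k))"
    if "S \<in> T" for S
    by (rule open_simplex_lattice_count[of S]) (use T(2)[OF that] lattice in blast)+
  then obtain q where q: "\<And>S. S \<in> T \<Longrightarrow> degree (q S) + 1 = card S"
      "\<And>S. S \<in> T \<Longrightarrow> coeff (q S) (degree (q S)) > 0"
      "\<And>S k. S \<in> T \<Longrightarrow> k > 0 \<Longrightarrow> finite (?dil k (?o S)) \<and> real (card (?dil k (?o S))) = poly (q S) (real k)"
    by metis
  define p where "p = (\<Sum>S\<in>T. q S)"
  obtain S0 where S0: "S0 \<in> T" "int (card S0) = polytope_dim P + 1" using card_eq by blast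
  define D where "D = degree (q S0)"
  have D: "polytope_dim P = int D" using q(1)[OF S0(1)] S0(2) unfolding D_def by linarith
  have deg_le: "degree (q S) \<le> D" if "S \<in> T" for S
    using q(1)[OF that] card_le[OF that] D by linarith
  have "coeff (q S) D \<ge> 0" if "S \<in> T" for S
    using q(2)[OF that] deg_le[OF that] by (cases "degree (q S) = D") (auto simp: coeff_eq_0)
  moreover have "coeff (q S0) D > 0" using q(2)[OF S0(1)] unfolding D_def .
  ultimately have "coeff p D > 0"
    unfolding p_def coeff_sum using T(1) S0(1) by (intro sum_pos2) auto
  moreover have "degree p \<le> D" unfolding p_def using T(1) deg_le by (intro degree_sum_le)
  ultimately have deg: "degree p = D" using le_degree[of p D] by simp
  have count: "finite (?dil k P) \<and> real (card (?dil k P)) = poly p (real k)" if k: "k > 0" for k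
  proof -
    have eq: "?dil k P = (\<Union>S\<in>T. ?dil k (?o S))" unfolding T(4)[symmetric] by blast
    have inj: "inj (\<lambda>x :: real ^ 'd. real k *\<^sub>R x)" using k by (simp add: inj_def)
    have disj: "?dil k (?o S) \<inter> ?dil k (?o S') = {}" if "S \<in> T" "S' \<in> T" "S \<noteq> S'" for S S'
    proof -
      have "?o S \<inter> ?o S' = {}" using T(3) that unfolding disjoint_family_on_def by blast
      then have "(\<lambda>x. real k *\<^sub>R x) ` ?o S \<inter> (\<lambda>x. real k *\<^sub>R x) ` ?o S' = {}"
        using image_Int[OF inj, of "?o S" "?o S'"] by simp
      then show ?thesis by blast
    qed
    have "card (?dil k P) = (\<Sum>S\<in>T. card (?dil k (?o S)))"
      unfolding eq using T(1) q(3) k disj by (intro card_UN_disjoint) auto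
    then have "real (card (?dil k P)) = poly p (real k)"
      unfolding p_def poly_sum using q(3) k by simp
    then show ?thesis unfolding eq using T(1) q(3) k by blast
  qed
  have cell: "compact C" "convex C" if "C \<in> cells P" for C
    using polytope_cell[OF P that] polytope_imp_compact polytope_imp_convex by blast+
  have compact: "compact P"
    using compact_Union[OF finite_cells[OF P] cell(1)] unfolding Union_cells[OF P] .
  \<comment> \<open>Convexity is available only for the cells; their frontiers are null sets and
    together contain the frontier of \<open>P\<close>.\<close>
  have "negligible (\<Union>C\<in>cells P. frontier C)"
    using finite_cells[OF P] cell(2) by (auto intro!: negligible_Union negligible_convex_frontier)
  then have neg: "negligible (frontier P)"
    using frontier_Union_subset[OF finite_cells[OF P]] negligible_subset unfolding Union_cells[OF P] by blast
  have dim_le: "polytope_dim P \<le> int CARD('d)"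
  proof -
    have "aff_dim S0 + 1 = int (card S0)" using T(2)[OF S0(1)] aff_dim_affine_independent by metis
    then show ?thesis using S0(2) aff_dim_le_DIM[of S0] by simp
  qed
  have "(\<lambda>n. poly p (real (Suc n)) / real (Suc n) ^ CARD('d)) \<longlonglongrightarrow> measure lebesgue P"
  proof -
    have c: "real (card (?dil (Suc n) P)) = poly p (real (Suc n))" for n
      using count[of "Suc n"] by blast
    show ?thesis
      by (rule lattice_count_tendsto_measure[OF compact neg, unfolded c]) (use count in blast)
  qed
  \<comment> \<open>If \<open>polytope_dim P\<close> is less than \<open>CARD('d)\<close>, both
    sides are 0.\<close>
  then have "coeff p CARD('d) = measure lebesgue P"
    using dim_le D deg by (intro coeff_eq_limit) auto
  then show ?thesis
    using dim_le deg D count lmeasurable_compact[OF compact] by (intro conjI exI[of _ p]) auto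
qed

end
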